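(* Suppose that $H$ is a word hyperbolic group, that $A$ is a finitely generated abelian group, and that $$1 \longrightarrow A \longrightarrow G \stackrel{\pi}{\longrightarrow} H \longrightarrow 1$$ is a central extension. Then there is a finite generating set $\mathcal{G}$ for $G$ such that $G$ is almost convex with respect to $\mathcal{G}$.
   Context: Generating sets: a generating set $\mathcal{G}$ of a group $G$ is always a finite subset of $G$ closed under inversion that generates $G$. The Cayley graph $\Gamma=\Gamma_{\mathcal{G}}(G)$ has vertex set $G$ and an edge from $g$ to $ga$ labelled $a$ for each $g\in G$, $a\in\mathcal{G}$; each edge is isometric to the unit interval and $d_{\mathcal{G}}$ is the induced path metric on $\Gamma$. For $x\in\Gamma$ put $\ell_{\mathcal{G}}(x)=d_{\mathcal{G}}(1,x)$, and let $B(r)=\{x\in\Gamma : \ell_{\mathcal{G}}(x)\le r\}$. Almost convexity: $G$ is almost convex $(m)$ with respect to $\mathcal{G}$ if there is a constant $K(m)$ such that whenever $n\ge 0$ is an integer and $g,g'\in G$ satisfy $\ell_{\mathcal{G}}(g)=\ell_{\mathcal{G}}(g')=n$ and $d_{\mathcal{G}}(g,g')\le m$, there is an edge path in $\Gamma$ from $g$ to $g'$ which lies inside $B(n)$ and has length at most $K(m)$. $G$ is almost convex with respect to $\mathcal{G}$ if it is almost convex $(m)$ with respect to $\mathcal{G}$ for all $m$. Word hyperbolic: a finitely generated group $H$ is word hyperbolic if for some (equivalently, every) finite generating set there is a constant $\delta$ such that in the corresponding Cayley graph each side of every geodesic triangle lies in the $\delta$-neighborhood of the union of the other two sides. *)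

theory Defs
  imports Complex_Main "HOL-Algebra.Generated_Groups"
begin

definition generating_set :: "('a, 'b) monoid_scheme \<Rightarrow> 'a set \<Rightarrow> bool" where
  "generating_set G S \<longleftrightarrow>
     finite S \<and> S \<subseteq> carrier G \<and> (\<forall>a\<in>S. inv\<^bsub>G\<^esub> a \<in> S) \<and> generate G S = carrier G"

definition finitely_generated :: "('a, 'b) monoid_scheme \<Rightarrow> bool" where
  "finitely_generated G \<longleftrightarrow> (\<exists>S. generating_set G S)"

text \<open>
  Points of the geometric realization of a Cayley graph: a vertex, or the point
  at parameter \<open>0 < t < 1\<close> on the edge from \<open>g\<close> to \<open>g a\<close> labelled \<open>a\<close>.  There is
  one edge for each pair \<open>(g, a)\<close>; the edges \<open>(g, a)\<close> and \<open>(g a, inv a)\<close> are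
  parallel and are not identified.
\<close>

datatype 'a cayley_point = Vertex 'a | Inner 'a 'a real

definition edge_point :: "('a, 'b) monoid_scheme \<Rightarrow> 'a \<Rightarrow> 'a \<Rightarrow> real \<Rightarrow> 'a cayley_point" where
  "edge_point G g a t =
     (if t = 0 then Vertex g else if t = 1 then Vertex (g \<otimes>\<^bsub>G\<^esub> a) else Inner g a t)"

definition cayley_edge :: "('a, 'b) monoid_scheme \<Rightarrow> 'a \<Rightarrow> 'a \<Rightarrow> 'a cayley_point set" where
  "cayley_edge G g a = edge_point G g a ` {0..1}"

definition cayley_graph :: "('a, 'b) monoid_scheme \<Rightarrow> 'a set \<Rightarrow> 'a cayley_point set" where
  "cayley_graph G S = Vertex ` carrier G \<union> (\<Union>g\<in>carrier G. \<Union>a\<in>S. cayley_edge G g a)"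

text \<open>
  \<open>pl_path G S x y l\<close>: there is a piecewise linear path of length \<open>l\<close> from \<open>x\<close> to
  \<open>y\<close>, that is, a finite concatenation of segments each contained in a closed edge.
  The path metric is the infimum of these lengths.
\<close>

inductive pl_path ::
    "('a, 'b) monoid_scheme \<Rightarrow> 'a set \<Rightarrow> 'a cayley_point \<Rightarrow> 'a cayley_point \<Rightarrow> real \<Rightarrow> bool"
  for G S where
  pl_refl: "x \<in> cayley_graph G S \<Longrightarrow> pl_path G S x x 0"
| pl_step: "\<lbrakk>g \<in> carrier G; a \<in> S; s \<in> {0..1}; t \<in> {0..1}; pl_path G S (edge_point G g a t) y l\<rbrakk>
    \<Longrightarrow> pl_path G S (edge_point G g a s) y (\<bar>s - t\<bar> + l)"

definition cayley_dist ::
    "('a, 'b) monoid_scheme \<Rightarrow> 'a set \<Rightarrow> 'a cayley_point \<Rightarrow> 'a cayley_point \<Rightarrow> real" where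
  "cayley_dist G S x y = Inf {l. pl_path G S x y l}"

definition cayley_length :: "('a, 'b) monoid_scheme \<Rightarrow> 'a set \<Rightarrow> 'a cayley_point \<Rightarrow> real" where
  "cayley_length G S x = cayley_dist G S (Vertex \<one>\<^bsub>G\<^esub>) x"

definition cayley_ball :: "('a, 'b) monoid_scheme \<Rightarrow> 'a set \<Rightarrow> real \<Rightarrow> 'a cayley_point set" where
  "cayley_ball G S r = {x \<in> cayley_graph G S. cayley_length G S x \<le> r}"

text \<open>
  An edge path starting at \<open>g\<close> is given by the list \<open>w\<close> of its edge labels.  It ends
  at \<open>foldl (\<otimes>) g w\<close>, and \<open>edge_path_trace G g w\<close> is the set of all points it passes
  through, including the interior points of its edges.
\<close>

primrec edge_path_trace :: "('a, 'b) monoid_scheme \<Rightarrow> 'a \<Rightarrow> 'a list \<Rightarrow> 'a cayley_point set" where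
  "edge_path_trace G g [] = {Vertex g}"
| "edge_path_trace G g (a # w) = cayley_edge G g a \<union> edge_path_trace G (g \<otimes>\<^bsub>G\<^esub> a) w"

definition almost_convex_at :: "('a, 'b) monoid_scheme \<Rightarrow> 'a set \<Rightarrow> nat \<Rightarrow> bool" where
  "almost_convex_at G S m \<longleftrightarrow>
     (\<exists>K::nat. \<forall>n::nat. \<forall>g\<in>carrier G. \<forall>g'\<in>carrier G.
        cayley_length G S (Vertex g) = real n \<and> cayley_length G S (Vertex g') = real n \<and>
        cayley_dist G S (Vertex g) (Vertex g') \<le> real m \<longrightarrow>
        (\<exists>w\<in>lists S. foldl (\<otimes>\<^bsub>G\<^esub>) g w = g' \<and>
           edge_path_trace G g w \<subseteq> cayley_ball G S (real n) \<and> length w \<le> K))"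

definition almost_convex :: "('a, 'b) monoid_scheme \<Rightarrow> 'a set \<Rightarrow> bool" where
  "almost_convex G S \<longleftrightarrow> (\<forall>m. almost_convex_at G S m)"

definition geodesic_segment ::
    "('a, 'b) monoid_scheme \<Rightarrow> 'a set \<Rightarrow> 'a cayley_point \<Rightarrow> 'a cayley_point \<Rightarrow> 'a cayley_point set \<Rightarrow> bool"
  where
  "geodesic_segment G S x y P \<longleftrightarrow>
     (\<exists>\<gamma> L. 0 \<le> L \<and> \<gamma> ` {0..L} \<subseteq> cayley_graph G S \<and> \<gamma> 0 = x \<and> \<gamma> L = y \<and>
        (\<forall>s\<in>{0..L}. \<forall>t\<in>{0..L}. cayley_dist G S (\<gamma> s) (\<gamma> t) = \<bar>s - t\<bar>) \<and>
        P = \<gamma> ` {0..L})"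

definition cayley_nbhd ::
    "('a, 'b) monoid_scheme \<Rightarrow> 'a set \<Rightarrow> real \<Rightarrow> 'a cayley_point set \<Rightarrow> 'a cayley_point set" where
  "cayley_nbhd G S \<delta> Q = {x \<in> cayley_graph G S. \<exists>q\<in>Q. cayley_dist G S x q \<le> \<delta>}"

definition thin_triangles :: "('a, 'b) monoid_scheme \<Rightarrow> 'a set \<Rightarrow> real \<Rightarrow> bool" where
  "thin_triangles G S \<delta> \<longleftrightarrow>
     (\<forall>x y z P Q R.
        geodesic_segment G S x y P \<and> geodesic_segment G S y z Q \<and> geodesic_segment G S z x R \<longrightarrow>
        P \<subseteq> cayley_nbhd G S \<delta> (Q \<union> R) \<and>
        Q \<subseteq> cayley_nbhd G S \<delta> (R \<union> P) \<and>
        R \<subseteq> cayley_nbhd G S \<delta> (P \<union> Q))"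

definition word_hyperbolic :: "('a, 'b) monoid_scheme \<Rightarrow> bool" where
  "word_hyperbolic H \<longleftrightarrow>
     group H \<and> (\<exists>S. generating_set H S \<and> (\<exists>\<delta>. thin_triangles H S \<delta>))"

text \<open>
  The library's \<open>short_exact_sequence\<close> forces all groups to have the same element
  type, so exactness is spelled out here.
\<close>

definition central_extension ::
    "('a, 'd) monoid_scheme \<Rightarrow> ('g, 'e) monoid_scheme \<Rightarrow> ('h, 'f) monoid_scheme \<Rightarrow>
      ('a \<Rightarrow> 'g) \<Rightarrow> ('g \<Rightarrow> 'h) \<Rightarrow> bool" where
  "central_extension A G H \<iota> \<pi> \<longleftrightarrow>
     group A \<and> group G \<and> group H \<and>
     \<iota> \<in> hom A G \<and> inj_on \<iota> (carrier A) \<and>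
     \<pi> \<in> hom G H \<and> \<pi> ` carrier G = carrier H \<and>
     \<iota> ` carrier A = kernel G H \<pi> \<and>
     (\<forall>a\<in>carrier A. \<forall>g\<in>carrier G. \<iota> a \<otimes>\<^bsub>G\<^esub> g = g \<otimes>\<^bsub>G\<^esub> \<iota> a)"

end

theory Submission
  imports Defs "HOL-Library.Multiset"
begin

text \<open>
  Let \<open>Y\<close> be a symmetric finite lift to \<open>G\<close> of a generating set of \<open>H\<close>, and let \<open>N\<close> be large compared
  with the thinness constant of \<open>H\<close>. Shortening a word over \<open>Y\<close> of length at most \<open>N\<close> whose image in \<open>H\<close>
  is not geodesic costs an element of a finite set \<open>Z\<^sub>0\<close> in the central kernel. Let \<open>Z\<close> consist of the products of
  at most four elements of \<open>Z\<^sub>0\<close> and of generators of the kernel, and take \<open>Y \<union> Z\<close> as generating set of \<open>G\<close>.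
  Dehn's algorithm in \<open>H\<close> writes a word of length \<open>l\<close> over \<open>Y\<close> with trivial image as a product of about
  \<open>l / 4\<close> elements of \<open>Z\<close>, and every \<open>g\<close> has a geodesic word \<open>w z\<close> with \<open>z\<close> over \<open>Z\<close> and \<open>w\<close> over \<open>Y\<close>
  mapping to an \<open>N\<close>-local geodesic of \<open>H\<close>.

  Let \<open>w z\<close> and \<open>w' z'\<close> be two such words of length \<open>n\<close> with nearby ends. If \<open>w\<close> is long, then \<open>w\<close> and \<open>w'\<close> fellow
  travel in \<open>H\<close>, with a constant independent of the distance of the ends. After going back by a large constant \<open>C\<close>
  the two points differ by an element of \<open>Y \<union> Z\<close>-length less than \<open>C\<close>, because a
  loop of length about \<open>2 C\<close> in \<open>H\<close> contributes only about \<open>C / 2\<close> letters of \<open>Z\<close>. If \<open>w\<close> is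
  short, then so is \<open>w'\<close>, and Dickson's lemma provides an element of the kernel from which both
  points are reached along geodesics of bounded length.
\<close>

section \<open>Word length\<close>

definition wprod :: "('a, 'b) monoid_scheme \<Rightarrow> 'a list \<Rightarrow> 'a" where
  "wprod G w = foldr (\<otimes>\<^bsub>G\<^esub>) w \<one>\<^bsub>G\<^esub>"

definition wlen :: "('a, 'b) monoid_scheme \<Rightarrow> 'a set \<Rightarrow> 'a \<Rightarrow> nat" where
  "wlen G S g = (LEAST n. \<exists>w\<in>lists S. length w = n \<and> wprod G w = g)"

definition wdist :: "('a, 'b) monoid_scheme \<Rightarrow> 'a set \<Rightarrow> 'a \<Rightarrow> 'a \<Rightarrow> nat" where
  "wdist G S g h = wlen G S (inv\<^bsub>G\<^esub> g \<otimes>\<^bsub>G\<^esub> h)"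

lemma wprod_Nil [simp]: "wprod G [] = \<one>\<^bsub>G\<^esub>"
  and wprod_Cons [simp]: "wprod G (a # w) = a \<otimes>\<^bsub>G\<^esub> wprod G w"
  by (simp_all add: wprod_def)

context group
begin

lemma wprod_closed [simp]: "set w \<subseteq> carrier G \<Longrightarrow> wprod G w \<in> carrier G"
  by (induction w) auto

lemma wprod_append:
  "set u \<subseteq> carrier G \<Longrightarrow> set v \<subseteq> carrier G \<Longrightarrow> wprod G (u @ v) = wprod G u \<otimes> wprod G v"
  by (induction u) (auto simp: m_assoc)

lemma wprod_inv:
  "set w \<subseteq> carrier G \<Longrightarrow> wprod G (map (m_inv G) (rev w)) = inv (wprod G w)"
proof (induction w)
  case (Cons a w)
  then have "set (map (m_inv G) (rev w)) \<subseteq> carrier G" by auto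
  with Cons show ?case by (simp add: wprod_append inv_mult_group)
qed simp

lemma hom_wprod:
  assumes "group H" "f \<in> hom G H" "set w \<subseteq> carrier G"
  shows "f (wprod G w) = wprod H (map f w)"
  using assms(3)
proof (induction w)
  case Nil
  show ?case using hom_one[OF assms(2) is_group assms(1)] by simp
next
  case (Cons a w)
  then show ?case using hom_mult[OF assms(2)] by simp
qed

lemma generate_wprod:
  assumes "T \<subseteq> carrier G" "\<And>a. a \<in> T \<Longrightarrow> inv a \<in> T"
  shows "generate G T = wprod G ` lists T"
proof (intro equalityI subsetI)
  fix x assume "x \<in> generate G T"
  then show "x \<in> wprod G ` lists T"
  proof induction
    case one
    show ?case by (rule image_eqI[where x="[]"]) auto
  next
    case (incl h)
    then show ?case using assms by (intro image_eqI[where x="[h]"]) auto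
  next
    case (inv h)
    then show ?case using assms by (intro image_eqI[where x="[inv h]"]) auto
  next
    case (eng h1 h2)
    then obtain u v where "u \<in> lists T" "v \<in> lists T" "h1 = wprod G u" "h2 = wprod G v" by auto
    moreover have "h1 \<otimes> h2 = wprod G (u @ v)"
    proof -
      have "set u \<subseteq> carrier G" "set v \<subseteq> carrier G" using calculation assms(1) by auto
      then show ?thesis using calculation by (simp add: wprod_append)
    qed
    ultimately show ?case by (intro image_eqI[where x="u @ v"]) auto
  qed
next
  fix x assume "x \<in> wprod G ` lists T"
  then obtain w where "w \<in> lists T" "x = wprod G w" by auto
  then show "x \<in> generate G T"
    by (induction w arbitrary: x) (auto intro: generate.intros)
qed

text \<open>The first letter of \<open>u\<close> is located inside \<open>v\<close>. It commutes
  with all letters in front of it, so it can be brought to the front and cancelled from both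
  words.\<close>

lemma wprod_perm:
  assumes "mset u = mset v" "set u \<subseteq> carrier G"
    "\<And>x y. x \<in> set u \<Longrightarrow> y \<in> set u \<Longrightarrow> x \<otimes> y = y \<otimes> x"
  shows "wprod G u = wprod G v"
  using assms
proof (induction u arbitrary: v)
  case (Cons a u)
  then obtain v1 v2 where v: "v = v1 @ a # v2"
    by (metis list.set_intros(1) mset_eq_setD split_list)
  have sv: "set v = set (a # u)" using Cons.prems(1) mset_eq_setD by metis
  have "set v1 \<subseteq> set (a # u)" using sv v by auto
  then have comm: "wprod G v1 \<otimes> a = a \<otimes> wprod G v1"
  proof (induction v1)
    case (Cons b v1)
    then have "b \<in> carrier G" "a \<in> carrier G" "set v1 \<subseteq> carrier G"
      using Cons.prems \<open>set (a # u) \<subseteq> carrier G\<close> by auto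
    moreover have "b \<otimes> a = a \<otimes> b"
      using Cons.prems \<open>\<And>x y. x \<in> set (a # u) \<Longrightarrow> y \<in> set (a # u) \<Longrightarrow> x \<otimes> y = y \<otimes> x\<close> by simp
    ultimately show ?case using Cons by (simp add: m_assoc) (simp flip: m_assoc)
  qed (use Cons.prems in simp)
  have "mset u = mset (v1 @ v2)" using Cons.prems(1) v by simp
  then have "wprod G u = wprod G (v1 @ v2)" using Cons by auto
  moreover have "set v1 \<subseteq> carrier G" "set v2 \<subseteq> carrier G" "a \<in> carrier G"
  proof -
    have "set v \<subseteq> carrier G" using sv Cons.prems(2) by simp
    then show "set v1 \<subseteq> carrier G" "set v2 \<subseteq> carrier G" "a \<in> carrier G" using v by auto
  qed
  ultimately show ?case using v comm by (simp add: wprod_append) (simp flip: m_assoc)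
qed simp

end

section \<open>The word metric of a symmetric generating set\<close>

locale cayley = group G for G (structure) +
  fixes S
  assumes S_sub: "S \<subseteq> carrier G"
    and S_inv: "a \<in> S \<Longrightarrow> inv a \<in> S"
    and S_gen: "generate G S = carrier G"
begin

lemma lists_carrier: "w \<in> lists S \<Longrightarrow> set w \<subseteq> carrier G"
  using S_sub by auto

lemma wprod_lists [simp]: "w \<in> lists S \<Longrightarrow> wprod G w \<in> carrier G"
  by (simp add: lists_carrier del: in_lists_conv_set)

lemma wprod_append_lists:
  "u \<in> lists S \<Longrightarrow> v \<in> lists S \<Longrightarrow> wprod G (u @ v) = wprod G u \<otimes> wprod G v"
  by (simp add: lists_carrier wprod_append del: in_lists_conv_set)

lemma ex_word: "g \<in> carrier G \<Longrightarrow> \<exists>w\<in>lists S. wprod G w = g"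
  using generate_wprod[OF S_sub S_inv] S_gen by auto

lemma ex_geodesic_word:
  assumes "g \<in> carrier G"
  obtains w where "w \<in> lists S" "length w = wlen G S g" "wprod G w = g"
proof -
  have "\<exists>n. \<exists>w\<in>lists S. length w = n \<and> wprod G w = g" using ex_word[OF assms] by auto
  then have "\<exists>w\<in>lists S. length w = wlen G S g \<and> wprod G w = g"
    unfolding wlen_def by (rule LeastI_ex)
  then show ?thesis using that by blast
qed

lemma wlen_le: "w \<in> lists S \<Longrightarrow> wlen G S (wprod G w) \<le> length w"
  unfolding wlen_def by (rule Least_le) auto

lemma wlen_one [simp]: "wlen G S \<one> = 0"
  using wlen_le[of "[]"] by simp

lemma wlen_mult:
  assumes "g \<in> carrier G" "h \<in> carrier G"
  shows "wlen G S (g \<otimes> h) \<le> wlen G S g + wlen G S h"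
proof -
  obtain u where u: "u \<in> lists S" "length u = wlen G S g" "wprod G u = g"
    using ex_geodesic_word[OF assms(1)] .
  obtain v where v: "v \<in> lists S" "length v = wlen G S h" "wprod G v = h"
    using ex_geodesic_word[OF assms(2)] .
  have "u @ v \<in> lists S" using u v by simp
  from wlen_le[OF this] show ?thesis using u v wprod_append_lists[OF u(1) v(1)] by simp
qed

lemma wlen_gen: "a \<in> S \<Longrightarrow> wlen G S a \<le> 1"
  using wlen_le[of "[a]"] S_sub by auto

lemma wlen_inv_le:
  assumes "g \<in> carrier G" shows "wlen G S (inv g) \<le> wlen G S g"
proof -
  obtain u where u: "u \<in> lists S" "length u = wlen G S g" "wprod G u = g"
    using ex_geodesic_word[OF assms] .
  have "map (m_inv G) (rev u) \<in> lists S" using u S_inv by auto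
  from wlen_le[OF this] show ?thesis using u wprod_inv[OF lists_carrier[OF u(1)]] by simp
qed

lemma wlen_inv: "g \<in> carrier G \<Longrightarrow> wlen G S (inv g) = wlen G S g"
  using wlen_inv_le[of g] wlen_inv_le[of "inv g"] by simp

lemma wlen_eq_1: "g \<in> carrier G \<Longrightarrow> wlen G S g = 1 \<Longrightarrow> g \<in> S"
proof -
  assume "g \<in> carrier G" "wlen G S g = 1"
  then obtain w where "w \<in> lists S" "length w = 1" "wprod G w = g"
    using ex_geodesic_word[of g] by auto
  then show "g \<in> S" using S_sub by (cases w) auto
qed

lemma wdist_self [simp]: "g \<in> carrier G \<Longrightarrow> wdist G S g g = 0"
  by (simp add: wdist_def)

lemma wdist_sym: "g \<in> carrier G \<Longrightarrow> h \<in> carrier G \<Longrightarrow> wdist G S g h = wdist G S h g"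
  using wlen_inv[of "inv g \<otimes> h"] by (simp add: wdist_def inv_mult_group)

lemma wdist_triangle:
  assumes "g \<in> carrier G" "h \<in> carrier G" "k \<in> carrier G"
  shows "wdist G S g k \<le> wdist G S g h + wdist G S h k"
proof -
  have "inv g \<otimes> k = (inv g \<otimes> h) \<otimes> (inv h \<otimes> k)"
    using assms by (simp add: m_assoc) (simp flip: m_assoc)
  then show ?thesis using assms by (simp add: wdist_def wlen_mult)
qed

lemma wdist_mult_right:
  assumes "g \<in> carrier G" "h \<in> carrier G"
  shows "wdist G S g (g \<otimes> h) = wlen G S h"
  using assms by (simp add: wdist_def) (simp flip: m_assoc)

end

section \<open>Local geodesics in discrete hyperbolic spaces\<close>

text \<open>Paths are total functions on the naturals of which only the values up to
  \<open>L\<close> matter. Asking for \<open>i \<le> j\<close> keeps the subtraction from being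
  truncated.\<close>

definition disc_geod :: "'v set \<Rightarrow> ('v \<Rightarrow> 'v \<Rightarrow> nat) \<Rightarrow> nat \<Rightarrow> (nat \<Rightarrow> 'v) \<Rightarrow> bool" where
  "disc_geod V d L p \<longleftrightarrow>
     (\<forall>i\<le>L. p i \<in> V) \<and> (\<forall>i j. i \<le> j \<longrightarrow> j \<le> L \<longrightarrow> d (p i) (p j) = j - i)"

definition local_geod :: "'v set \<Rightarrow> ('v \<Rightarrow> 'v \<Rightarrow> nat) \<Rightarrow> nat \<Rightarrow> nat \<Rightarrow> (nat \<Rightarrow> 'v) \<Rightarrow> bool" where
  "local_geod V d N L p \<longleftrightarrow>
     (\<forall>i\<le>L. p i \<in> V) \<and> (\<forall>i j. i \<le> j \<longrightarrow> j \<le> L \<longrightarrow> j - i \<le> N \<longrightarrow> d (p i) (p j) = j - i)"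

text \<open>This abstracts the vertex set of a Cayley graph with its integer metric. Thinness is
  stated for the first side of a cyclically oriented triangle; rotating the triangle gives it for
  the other two.\<close>

locale disc_hyperbolic =
  fixes V :: "'v set" and d :: "'v \<Rightarrow> 'v \<Rightarrow> nat" and \<delta> :: nat
  assumes d_self: "x \<in> V \<Longrightarrow> d x x = 0"
    and d_sym: "x \<in> V \<Longrightarrow> y \<in> V \<Longrightarrow> d x y = d y x"
    and d_tri: "x \<in> V \<Longrightarrow> y \<in> V \<Longrightarrow> z \<in> V \<Longrightarrow> d x z \<le> d x y + d y z"
    and ex_geod: "x \<in> V \<Longrightarrow> y \<in> V \<Longrightarrow> \<exists>p. disc_geod V d (d x y) p \<and> p 0 = x \<and> p (d x y) = y"
    and thin: "disc_geod V d A p \<Longrightarrow> disc_geod V d B q \<Longrightarrow> disc_geod V d C r \<Longrightarrow>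
      p A = q 0 \<Longrightarrow> q B = r 0 \<Longrightarrow> r C = p 0 \<Longrightarrow> i \<le> A \<Longrightarrow>
      (\<exists>j\<le>B. d (p i) (q j) \<le> \<delta>) \<or> (\<exists>j\<le>C. d (p i) (r j) \<le> \<delta>)"
begin

section \<open>Reversing and cutting geodesics, thin quadrilaterals\<close>

lemma geod_in: "disc_geod V d L p \<Longrightarrow> i \<le> L \<Longrightarrow> p i \<in> V"
  by (simp add: disc_geod_def)

lemma local_in: "local_geod V d N L p \<Longrightarrow> i \<le> L \<Longrightarrow> p i \<in> V"
  by (simp add: local_geod_def)

lemma geod_rev:
  assumes "disc_geod V d L p" shows "disc_geod V d L (\<lambda>i. p (L - i))"
proof -
  have "d (p (L - i)) (p (L - j)) = j - i" if "i \<le> j" "j \<le> L" for i j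
  proof -
    have "d (p (L - j)) (p (L - i)) = (L - i) - (L - j)"
      using assms that unfolding disc_geod_def by simp
    then show ?thesis using that assms by (simp add: d_sym geod_in)
  qed
  then show ?thesis using assms unfolding disc_geod_def by simp
qed

lemma geod_sub:
  "disc_geod V d L p \<Longrightarrow> a \<le> b \<Longrightarrow> b \<le> L \<Longrightarrow> disc_geod V d (b - a) (\<lambda>i. p (a + i))"
  by (auto simp: disc_geod_def)

lemma local_geod_sub:
  "local_geod V d N L p \<Longrightarrow> a \<le> b \<Longrightarrow> b \<le> L \<Longrightarrow> b - a \<le> N \<Longrightarrow> disc_geod V d (b - a) (\<lambda>i. p (a + i))"
  by (auto simp: disc_geod_def local_geod_def)

lemma thin':
  assumes "disc_geod V d A p" "disc_geod V d B q" "disc_geod V d C r"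
    "p 0 = q 0" "q B = r 0" "r C = p A" "i \<le> A"
  shows "(\<exists>j\<le>B. d (p i) (q j) \<le> \<delta>) \<or> (\<exists>j\<le>C. d (p i) (r j) \<le> \<delta>)"
proof -
  have "(\<exists>j\<le>B. d (p (A - (A - i))) (q j) \<le> \<delta>) \<or> (\<exists>j\<le>C. d (p (A - (A - i))) (r j) \<le> \<delta>)"
    by (rule thin[OF geod_rev[OF assms(1)] assms(2,3)]) (use assms in auto)
  then show ?thesis using assms(7) by simp
qed

text \<open>A diagonal from \<open>q 0\<close> to \<open>r C\<close> cuts the quadrilateral into two
  thin triangles, and a point of \<open>p\<close> crosses at most both of them.\<close>

lemma quad_thin:
  assumes "disc_geod V d A p" "disc_geod V d B q" "disc_geod V d C r" "disc_geod V d D s"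
    "p 0 = q 0" "q B = r 0" "r C = s 0" "s D = p A" "i \<le> A"
  shows "(\<exists>j\<le>B. d (p i) (q j) \<le> 2 * \<delta>) \<or> (\<exists>j\<le>C. d (p i) (r j) \<le> 2 * \<delta>) \<or> (\<exists>j\<le>D. d (p i) (s j) \<le> 2 * \<delta>)"
proof -
  have V: "q 0 \<in> V" "r C \<in> V" "p i \<in> V" using assms geod_in by auto
  obtain t where t: "disc_geod V d (d (q 0) (r C)) t" "t 0 = q 0" "t (d (q 0) (r C)) = r C"
    using ex_geod V by blast
  let ?T = "d (q 0) (r C)"
  have "(\<exists>j\<le>?T. d (p i) (t j) \<le> \<delta>) \<or> (\<exists>j\<le>D. d (p i) (s j) \<le> \<delta>)"
    by (rule thin'[OF assms(1) t(1) assms(4)]) (use t assms in auto)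
  then consider k where "k \<le> ?T" "d (p i) (t k) \<le> \<delta>" | j where "j \<le> D" "d (p i) (s j) \<le> \<delta>"
    by blast
  then show ?thesis
  proof cases
    case 1
    have tk: "t k \<in> V" using t 1 geod_in by blast
    have "(\<exists>j\<le>B. d (t k) (q j) \<le> \<delta>) \<or> (\<exists>j\<le>C. d (t k) (r j) \<le> \<delta>)"
      by (rule thin'[OF t(1) assms(2,3)]) (use t assms 1 in auto)
    moreover have "d (p i) y \<le> 2 * \<delta>" if "d (t k) y \<le> \<delta>" "y \<in> V" for y
      using d_tri[OF V(3) tk that(2)] that 1 by linarith
    ultimately show ?thesis using assms(2,3) geod_in by meson
  next
    case 2
    then have "d (p i) (s j) \<le> 2 * \<delta>" by simp
    then show ?thesis using 2 by blast
  qed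
qed

section \<open>Stability of local geodesics\<close>

lemma geod_seg:
  assumes "disc_geod V d L p" "a \<le> L" "b \<le> L"
  obtains T t where "disc_geod V d T t" "t 0 = p a" "t T = p b" "\<And>j. j \<le> T \<Longrightarrow> \<exists>k\<le>L. t j = p k"
proof (cases "a \<le> b")
  case True
  show ?thesis
  proof (rule that[OF geod_sub[OF assms(1) True assms(3)]])
    show "\<exists>k\<le>L. p (a + j) = p k" if "j \<le> b - a" for j
      using that True assms by (intro exI[of _ "a + j"]) auto
  qed (use True in auto)
next
  case False
  then have ba: "b \<le> a" by simp
  show ?thesis
  proof (rule that[OF geod_rev[OF geod_sub[OF assms(1) ba assms(2)]]])
    show "\<exists>k\<le>L. p (b + (a - b - j)) = p k" if "j \<le> a - b" for j
      using that ba assms by (intro exI[of _ "b + (a - b - j)"]) auto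
  qed (use ba in auto)
qed

text \<open>The point of \<open>c\<close> farthest from \<open>p\<close> is compared with the two
  points of \<open>c\<close> at parameter distance \<open>k\<close> on either side of it. These two
  points and their projections to \<open>p\<close> span a quadrilateral with geodesic sides. Being
  close to one of the sides leading to \<open>p\<close> would make the farthest point closer to
  \<open>p\<close> than it is, so it is close to \<open>p\<close> itself.\<close>

lemma local_geod_near_geod:
  assumes c: "local_geod V d N L c" and N: "8 * \<delta> + 2 \<le> N"
    and p: "disc_geod V d l p" and ends: "p 0 = c 0" "p l = c L" and i: "i \<le> L"
  shows "\<exists>j\<le>l. d (c i) (p j) \<le> 2 * \<delta>"
proof -
  define D where "D i = Min ((\<lambda>j. d (c i) (p j)) ` {..l})" for i
  have D_le: "D i \<le> d (c i) (p j)" if "j \<le> l" for i j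
    unfolding D_def using that by (intro Min_le) auto
  have D_ex: "\<exists>j\<le>l. d (c i) (p j) = D i" for i
  proof -
    have "D i \<in> (\<lambda>j. d (c i) (p j)) ` {..l}" unfolding D_def by (rule Min_in) auto
    then show ?thesis by auto
  qed
  define M where "M = Max (D ` {..L})"
  have "M \<in> D ` {..L}" unfolding M_def by (rule Max_in) auto
  then obtain x where x: "x \<le> L" "D x = M" by auto
  have max: "D y \<le> D x" if "y \<le> L" for y
    unfolding x M_def using that by (intro Max_ge) auto
  \<comment> \<open>Exceeding \<open>4 * \<delta>\<close> makes the comparison in \<open>far\<close>
    strict, and \<open>2 * k \<le> N\<close> makes the arc between the two chosen points
    geodesic.\<close>
  define k where "k = 4 * \<delta> + 1"
  \<comment> \<open>Near an end of \<open>c\<close> the arc is cut off there; natural subtraction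
    does this at 0. The ends of \<open>c\<close> lie on \<open>p\<close>, so the corresponding side
    of the quadrilateral is degenerate.\<close>
  define y z where "y = x - k" and "z = min L (x + k)"
  have yz: "y \<le> x" "x \<le> z" "z \<le> L" "z - y \<le> N" "y \<le> z" "y \<le> L"
    using x N by (auto simp: y_def z_def k_def)
  obtain y' where y': "y' \<le> l" "d (c y) (p y') = D y" using D_ex by blast
  obtain z' where z': "z' \<le> l" "d (c z) (p z') = D z" using D_ex by blast
  have cV: "c x \<in> V" "c y \<in> V" "c z \<in> V" "p y' \<in> V" "p z' \<in> V"
    using local_in[OF c] geod_in[OF p] yz x y' z' by auto
  have D0: "D 0 = 0" using D_le[of 0 0] ends cV local_in[OF c] d_self by auto
  have DL: "D L = 0" using D_le[of l L] ends cV local_in[OF c] d_self by auto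
  \<comment> \<open>A point on the segment from an end of the arc to its projection cannot be close to
      the farthest point, unless the segment is degenerate.\<close>
  have far: "D x \<le> 2 * \<delta>"
    if w: "s \<in> V" "d (c x) s \<le> 2 * \<delta>" "d (c e) s + d s (p e') = d (c e) (p e')"
      and e: "c e \<in> V" "e' \<le> l" "d (c e) (p e') = D e" "D e \<le> D x" "D e = 0 \<or> d (c e) (c x) = k" for s e e'
  proof -
    have V: "c x \<in> V" "p e' \<in> V" using cV geod_in[OF p] e by auto
    have 1: "D x \<le> d (c x) s + d s (p e')" using D_le[OF e(2), of x] d_tri[OF V(1) w(1) V(2)] by linarith
    have 2: "d (c e) (c x) \<le> d (c e) s + d (c x) s" using d_tri[OF e(1) w(1) V(1)] d_sym w V by simp
    show ?thesis
    proof (cases "D e = 0")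
      case True
      then show ?thesis using 1 w e by linarith
    next
      case False
      then have "d (c e) (c x) = k" using e by simp
      then show ?thesis using 1 2 w e unfolding k_def by linarith
    qed
  qed
  obtain q where q: "disc_geod V d (D y) q" "q 0 = c y" "q (D y) = p y'"
    using ex_geod[OF cV(2,4)] y' by auto
  obtain r where r: "disc_geod V d (D z) r" "r 0 = c z" "r (D z) = p z'"
    using ex_geod[OF cV(3,5)] z' by auto
  obtain T t where t: "disc_geod V d T t" "t 0 = p y'" "t T = p z'" "\<And>j. j \<le> T \<Longrightarrow> \<exists>k\<le>l. t j = p k"
    using geod_seg[OF p y'(1) z'(1)] by metis
  have "(\<exists>j\<le>D y. d (c (y + (x - y))) (q j) \<le> 2 * \<delta>) \<or> (\<exists>j\<le>T. d (c (y + (x - y))) (t j) \<le> 2 * \<delta>)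
      \<or> (\<exists>j\<le>D z. d (c (y + (x - y))) (r (D z - j)) \<le> 2 * \<delta>)"
    by (rule quad_thin[OF local_geod_sub[OF c yz(5,3,4)] q(1) t(1) geod_rev[OF r(1)]])
      (use q t r yz in auto)
  then have "(\<exists>j\<le>D y. d (c x) (q j) \<le> 2 * \<delta>) \<or> (\<exists>j\<le>T. d (c x) (t j) \<le> 2 * \<delta>)
      \<or> (\<exists>j\<le>D z. d (c x) (r j) \<le> 2 * \<delta>)"
    using yz by simp (meson diff_le_self)
  then consider (1) j where "j \<le> D y" "d (c x) (q j) \<le> 2 * \<delta>" | (2) j where "j \<le> T" "d (c x) (t j) \<le> 2 * \<delta>"
    | (3) j where "j \<le> D z" "d (c x) (r j) \<le> 2 * \<delta>" by blast
  then have "D x \<le> 2 * \<delta>"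
  proof cases
    case 1
    have "d (c y) (q j) + d (q j) (p y') = D y"
      using q(1) 1 unfolding disc_geod_def q(2)[symmetric] q(3)[symmetric] by simp
    moreover have "D y = 0 \<or> d (c y) (c x) = k"
    proof (cases "x \<le> k")
      case False
      then have "x - y = k" "x - y \<le> N" using N by (auto simp: y_def k_def)
      then show ?thesis using c yz x unfolding local_geod_def by simp
    qed (simp add: y_def D0)
    ultimately show ?thesis
      using far[of "q j" y y'] 1 geod_in[OF q(1)] cV y' max yz by auto
  next
    case 2
    then obtain k where "k \<le> l" "t j = p k" using t by blast
    then show ?thesis using 2 D_le[of k x] by auto
  next
    case 3
    have "d (c z) (r j) + d (r j) (p z') = D z"
      using r(1) 3 unfolding disc_geod_def r(2)[symmetric] r(3)[symmetric] by simp
    moreover have "D z = 0 \<or> d (c z) (c x) = k"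
    proof (cases "L \<le> x + k")
      case False
      then have zk: "z - x = k" "z - x \<le> N" using N by (auto simp: z_def k_def)
      then have "d (c x) (c z) = k" using c yz x unfolding local_geod_def by simp
      then show ?thesis using d_sym cV by simp
    qed (simp add: z_def DL min_def)
    ultimately show ?thesis
      using far[of "r j" z z'] 3 geod_in[OF r(1)] cV z' max yz by auto
  qed
  then have "D i \<le> 2 * \<delta>" using max[OF i] by simp
  then show ?thesis using D_ex[of i] by auto
qed

text \<open>The constant path is a geodesic between the ends of a loop, so the whole loop stays
  within \<open>2 * \<delta>\<close> of its start. But it begins with a geodesic of length
  \<open>min L (4 * \<delta> + 1)\<close>, which forces that length to be \<open>L\<close> and the
  distance of the ends to be \<open>L\<close> as well.\<close>

lemma local_geod_loop:
  assumes c: "local_geod V d N L c" and N: "8 * \<delta> + 2 \<le> N" and loop: "c L = c 0"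
  shows "L = 0"
proof (rule ccontr)
  assume L: "L \<noteq> 0"
  have V: "c i \<in> V" if "i \<le> L" for i using c that local_in by blast
  define i where "i = min L (4 * \<delta> + 1)"
  have "d (c 0) (c i) = i" using c N unfolding local_geod_def by (auto simp: i_def)
  moreover have "d (c i) (c 0) \<le> 2 * \<delta>"
  proof -
    have 0: "c 0 \<in> V" by (rule V) simp
    have g: "disc_geod V d 0 (\<lambda>_. c 0)" using d_self[OF 0] 0 by (simp add: disc_geod_def)
    have "i \<le> L" by (simp add: i_def)
    from local_geod_near_geod[OF c N g refl loop[symmetric] this] show ?thesis by auto
  qed
  moreover have "d (c 0) (c i) = d (c i) (c 0)" by (intro d_sym V) (simp_all add: i_def)
  ultimately have "i \<le> 2 * \<delta>" by simp
  then have "i = L" by (auto simp: i_def)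
  then have "L = d (c 0) (c L)" using \<open>d (c 0) (c i) = i\<close> by simp
  then show False using loop d_self V L by simp
qed

text \<open>A discrete intermediate value principle for a function that may jump: the level
  \<open>k\<close> is either hit or crossed between two consecutive arguments.\<close>

lemma discrete_crossing:
  fixes f :: "nat \<Rightarrow> nat"
  assumes "f 0 \<le> k" "k \<le> f n"
  shows "\<exists>i\<le>n. f i \<le> k \<and> (k \<le> f i \<or> (i < n \<and> k \<le> f (Suc i)))"
  using assms
proof (induction n)
  case (Suc n)
  show ?case
  proof (cases "k \<le> f n")
    case True
    then show ?thesis using Suc by (meson le_Suc_eq less_SucI)
  next
    case False
    then show ?thesis using Suc by (intro exI[of _ n]) auto
  qed
qed auto

text \<open>Projections to \<open>p\<close> of consecutive points of \<open>c\<close> are at most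
  \<open>2 * \<delta> + 1 + 2 * \<delta>\<close> apart, so they leave no larger gap on
  \<open>p\<close>. Another \<open>2 * \<delta>\<close> leads from a projection back to
  \<open>c\<close>.\<close>

lemma geod_near_local_geod:
  assumes c: "local_geod V d N L c" and N: "8 * \<delta> + 2 \<le> N"
    and p: "disc_geod V d l p" and ends: "p 0 = c 0" "p l = c L" and k: "k \<le> l"
  shows "\<exists>i\<le>L. d (p k) (c i) \<le> 6 * \<delta> + 1"
proof -
  have cV: "c i \<in> V" if "i \<le> L" for i using c that local_in by blast
  have pV: "p i \<in> V" if "i \<le> l" for i using p that geod_in by blast
  \<comment> \<open>The projection is prescribed at both ends, so that its values start at 0 and
    finish at \<open>l\<close>; elsewhere any near point of \<open>p\<close> is chosen.\<close>
  define f where "f i = (if i = 0 then 0 else if L \<le> i then l else (SOME j. j \<le> l \<and> d (c i) (p j) \<le> 2 * \<delta>))" for i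
  have f: "f i \<le> l \<and> d (c i) (p (f i)) \<le> 2 * \<delta>" if "i \<le> L" for i
  proof -
    have "\<exists>j. j \<le> l \<and> d (c i) (p j) \<le> 2 * \<delta>"
      using local_geod_near_geod[OF c N p ends that] by blast
    then have "(SOME j. j \<le> l \<and> d (c i) (p j) \<le> 2 * \<delta>) \<le> l \<and>
        d (c i) (p (SOME j. j \<le> l \<and> d (c i) (p j) \<le> 2 * \<delta>)) \<le> 2 * \<delta>"
      by (rule someI_ex)
    moreover have "d (c 0) (p 0) = 0" "d (c L) (p l) = 0" using ends cV d_self by auto
    moreover have "i = L" if "L \<le> i" using \<open>i \<le> L\<close> that by simp
    ultimately show ?thesis unfolding f_def by auto
  qed
  show ?thesis
  proof (cases "L = 0")
    case True
    have "l = d (p 0) (p l)" using p by (simp add: disc_geod_def)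
    then have "l = 0" using ends True d_self cV by simp
    then show ?thesis using True k ends d_self cV by auto
  next
    case False
    then have "f 0 \<le> k" "k \<le> f L" using k by (auto simp: f_def)
    then obtain i where i: "i \<le> L" "f i \<le> k" "k \<le> f i \<or> (i < L \<and> k \<le> f (Suc i))"
      using discrete_crossing by blast
    have "k - f i \<le> 4 * \<delta> + 1"
    proof (cases "k \<le> f i")
      case False
      then have S: "i < L" "k \<le> f (Suc i)" using i by auto
      let ?a = "p (f i)" and ?b = "p (f (Suc i))"
      have V: "?a \<in> V" "?b \<in> V" "c i \<in> V" "c (Suc i) \<in> V" using f S pV cV by auto
      have "d ?a ?b = f (Suc i) - f i" using p f[of "Suc i"] S i unfolding disc_geod_def by simp
      moreover have "d (c i) (c (Suc i)) = 1" using c S N unfolding local_geod_def by simp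
      moreover have "d ?a ?b \<le> d ?a (c i) + d (c i) ?b" "d (c i) ?b \<le> d (c i) (c (Suc i)) + d (c (Suc i)) ?b"
        using d_tri V by auto
      moreover have "d ?a (c i) \<le> 2 * \<delta>" "d (c (Suc i)) ?b \<le> 2 * \<delta>"
        using f[of i] f[of "Suc i"] S d_sym V by auto
      ultimately show ?thesis using S by linarith
    qed simp
    moreover have "d (p (f i)) (p k) = k - f i" using p i k unfolding disc_geod_def by simp
    moreover have "p (f i) \<in> V" "p k \<in> V" "c i \<in> V" using f i pV cV k by auto
    ultimately have "d (p k) (c i) \<le> 6 * \<delta> + 1"
      using d_tri[of "p k" "p (f i)" "c i"] d_sym f[OF i(1)] by fastforce
    then show ?thesis using i by blast
  qed
qed

text \<open>The ends and the common start span a geodesic triangle. From \<open>c i\<close> one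
  passes to the first side (\<open>2 * \<delta>\<close>), to the second side
  (\<open>\<delta>\<close>) and to \<open>c'\<close> (\<open>6 * \<delta> + 1\<close>). The distance
  of the ends enters only through \<open>far\<close>, which rules out that the point of the first
  side is close to the third side.\<close>

lemma fellow_travel:
  assumes c: "local_geod V d N L c" "local_geod V d N L' c'" and N: "8 * \<delta> + 2 \<le> N"
    and start: "c 0 = c' 0" and i: "i \<le> L"
    and far: "d (c L) (c' L') + 3 * \<delta> < d (c i) (c L)"
  shows "\<exists>j\<le>L'. d (c i) (c' j) \<le> 9 * \<delta> + 1"
proof -
  have cV: "c 0 \<in> V" "c i \<in> V" "c L \<in> V" using c i local_in by auto
  have c'V: "c' j \<in> V" if "j \<le> L'" for j using c that local_in by auto
  let ?A = "d (c 0) (c L)" and ?B = "d (c 0) (c' L')" and ?C = "d (c' L') (c L)"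
  obtain p where p: "disc_geod V d ?A p" "p 0 = c 0" "p ?A = c L"
    using ex_geod[OF cV(1,3)] by blast
  obtain q where q: "disc_geod V d ?B q" "q 0 = c 0" "q ?B = c' L'"
    using ex_geod[OF cV(1) c'V[OF order_refl]] by blast
  obtain r where r: "disc_geod V d ?C r" "r 0 = c' L'" "r ?C = c L"
    using ex_geod[OF c'V[OF order_refl] cV(3)] by blast
  obtain a where a: "a \<le> ?A" "d (c i) (p a) \<le> 2 * \<delta>"
    using local_geod_near_geod[OF c(1) N p i] by blast
  have pa: "p a \<in> V" using p a geod_in by blast
  have "(\<exists>j\<le>?B. d (p a) (q j) \<le> \<delta>) \<or> (\<exists>j\<le>?C. d (p a) (r j) \<le> \<delta>)"
    by (rule thin'[OF p(1) q(1) r(1)]) (use p q r a in auto)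
  then show ?thesis
  proof (elim disjE exE conjE)
    fix b assume b: "b \<le> ?B" "d (p a) (q b) \<le> \<delta>"
    have qb: "q b \<in> V" using q b geod_in by blast
    obtain j where j: "j \<le> L'" "d (q b) (c' j) \<le> 6 * \<delta> + 1"
      using geod_near_local_geod[OF c(2) N q(1) _ _ b(1)] q start by auto
    have "d (c i) (c' j) \<le> 9 * \<delta> + 1"
      using d_tri[OF cV(2) pa c'V[OF j(1)]] d_tri[OF pa qb c'V[OF j(1)]] a b j by linarith
    then show ?thesis using j by blast
  next
    fix b assume b: "b \<le> ?C" "d (p a) (r b) \<le> \<delta>"
    have rb: "r b \<in> V" using r b geod_in by blast
    have "d (r b) (c L) \<le> d (c L) (c' L')"
      using r b d_sym cV c'V unfolding disc_geod_def by (metis diff_le_self order_refl)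
    then have "d (c i) (c L) \<le> d (c L) (c' L') + 3 * \<delta>"
      using d_tri[OF cV(2) pa cV(3)] d_tri[OF pa rb cV(3)] a b by linarith
    with far show ?thesis by simp
  qed
qed

end

section \<open>The Cayley graph\<close>

lemma edge_point_0 [simp]: "edge_point G g a 0 = Vertex g"
  and edge_point_1 [simp]: "edge_point G g a 1 = Vertex (g \<otimes>\<^bsub>G\<^esub> a)"
  by (simp_all add: edge_point_def)

context cayley
begin

section \<open>Piecewise linear paths and the path metric on vertices\<close>

lemma edge_point_in_graph:
  "g \<in> carrier G \<Longrightarrow> a \<in> S \<Longrightarrow> t \<in> {0..1} \<Longrightarrow> edge_point G g a t \<in> cayley_graph G S"
  unfolding cayley_graph_def cayley_edge_def by blast

lemma Vertex_in_graph: "g \<in> carrier G \<Longrightarrow> Vertex g \<in> cayley_graph G S"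
  unfolding cayley_graph_def by blast

lemma pl_path_nonneg: "pl_path G S x y l \<Longrightarrow> 0 \<le> l"
  by (induction rule: pl_path.induct) auto

lemma pl_path_trans:
  "pl_path G S x y l \<Longrightarrow> pl_path G S y z l' \<Longrightarrow> pl_path G S x z (l + l')"
proof (induction rule: pl_path.induct)
  case (pl_step g a s t y l)
  then show ?case using pl_path.pl_step[OF pl_step(1-4) pl_step.IH[OF pl_step.prems]]
    by (simp add: add.assoc)
qed simp

lemma pl_path_edge:
  assumes "g \<in> carrier G" "a \<in> S" "s \<in> {0..1}" "t \<in> {0..1}"
  shows "pl_path G S (edge_point G g a s) (edge_point G g a t) \<bar>s - t\<bar>"
  using pl_path.pl_step[OF assms pl_refl[OF edge_point_in_graph[OF assms(1,2,4)]]] by simp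

lemma pl_path_sym: "pl_path G S x y l \<Longrightarrow> pl_path G S y x l"
proof (induction rule: pl_path.induct)
  case (pl_refl x)
  then show ?case by (rule pl_path.pl_refl)
next
  case (pl_step g a s t y l)
  from pl_path_trans[OF pl_step.IH pl_path_edge[OF pl_step(1,2,4,3)]]
  show ?case by (simp add: abs_minus_commute add.commute)
qed

lemma pl_path_word:
  "w \<in> lists S \<Longrightarrow> g \<in> carrier G \<Longrightarrow>
    pl_path G S (Vertex g) (Vertex (g \<otimes> wprod G w)) (real (length w))"
proof (induction w arbitrary: g)
  case Nil
  then show ?case using pl_refl[OF Vertex_in_graph] by simp
next
  case (Cons a w)
  then have a: "a \<in> S" "a \<in> carrier G" "w \<in> lists S" using S_sub by auto
  have "pl_path G S (Vertex (g \<otimes> a)) (Vertex (g \<otimes> a \<otimes> wprod G w)) (real (length w))"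
    using Cons a by simp
  from pl_path_trans[OF pl_path_edge[OF Cons.prems(2) a(1), of 0 1, simplified] this]
  show ?case using Cons.prems a by (simp add: m_assoc del: in_lists_conv_set)
qed

text \<open>The distance from the vertex \<open>x\<close>, where an interior point of an edge is
  reached through the better of its two ends. It grows by at most \<open>l\<close> along a path of
  length \<open>l\<close>, which bounds path lengths from below.\<close>

definition height :: "'a \<Rightarrow> 'a cayley_point \<Rightarrow> real" where
  "height x p = (case p of Vertex g \<Rightarrow> real (wdist G S x g)
     | Inner g a t \<Rightarrow> min (real (wdist G S x g) + t) (real (wdist G S x (g \<otimes> a)) + 1 - t))"

lemma wdist_step:
  assumes "x \<in> carrier G" "g \<in> carrier G" "a \<in> S"
  shows "wdist G S x (g \<otimes> a) \<le> wdist G S x g + 1" "wdist G S x g \<le> wdist G S x (g \<otimes> a) + 1"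
proof -
  have a: "a \<in> carrier G" using assms S_sub by auto
  have "wdist G S g (g \<otimes> a) \<le> 1" using wdist_mult_right assms a wlen_gen by simp
  moreover from this have "wdist G S (g \<otimes> a) g \<le> 1" using wdist_sym assms a by simp
  ultimately show "wdist G S x (g \<otimes> a) \<le> wdist G S x g + 1" "wdist G S x g \<le> wdist G S x (g \<otimes> a) + 1"
    using wdist_triangle[of x g "g \<otimes> a"] wdist_triangle[of x "g \<otimes> a" g] assms a by auto
qed

text \<open>The word distances of the two ends differ by at most 1, so the minimum has the right
  value at \<open>t = 0\<close> and \<open>t = 1\<close> too.\<close>

lemma height_edge_point:
  assumes "x \<in> carrier G" "g \<in> carrier G" "a \<in> S" "t \<in> {0..1}"
  shows "height x (edge_point G g a t) =
    min (real (wdist G S x g) + t) (real (wdist G S x (g \<otimes> a)) + 1 - t)"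
  using wdist_step[OF assms(1-3)] assms(4) by (auto simp: height_def edge_point_def)

lemma height_pl_path:
  assumes "x \<in> carrier G" "pl_path G S p q l"
  shows "height x q \<le> height x p + l"
  using assms(2)
proof (induction rule: pl_path.induct)
  case (pl_step g a s t y l)
  have "height x (edge_point G g a t) \<le> height x (edge_point G g a s) + \<bar>s - t\<bar>"
    using height_edge_point[OF assms(1) pl_step(1,2)] pl_step(3,4) by auto
  then show ?case using pl_step by linarith
qed simp

lemma cayley_dist_le: "pl_path G S p q l \<Longrightarrow> cayley_dist G S p q \<le> l"
  unfolding cayley_dist_def
  by (rule cInf_lower) (auto intro!: bdd_belowI[of _ 0] dest: pl_path_nonneg)

text \<open>The path in the first assumption keeps the set of lengths nonempty, since
  \<open>Inf {}\<close> is an unspecified real.\<close>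

lemma cayley_dist_ge:
  assumes "pl_path G S p q l" "\<And>l. pl_path G S p q l \<Longrightarrow> m \<le> l"
  shows "m \<le> cayley_dist G S p q"
  unfolding cayley_dist_def by (rule cInf_greatest) (use assms in auto)

lemma pl_path_vertices_ge:
  assumes "g \<in> carrier G" "h \<in> carrier G" "pl_path G S (Vertex g) (Vertex h) l"
  shows "real (wdist G S g h) \<le> l"
  using height_pl_path[OF assms(1,3)] assms by (simp add: height_def)

lemma pl_path_vertices:
  assumes "g \<in> carrier G" "h \<in> carrier G"
  shows "pl_path G S (Vertex g) (Vertex h) (real (wdist G S g h))"
proof -
  have "inv g \<otimes> h \<in> carrier G" using assms by simp
  then obtain w where w: "w \<in> lists S" "length w = wdist G S g h" "wprod G w = inv g \<otimes> h"
    using ex_geodesic_word wdist_def by metis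
  have "g \<otimes> (inv g \<otimes> h) = h" using assms by (simp flip: m_assoc)
  then show ?thesis using pl_path_word[OF w(1) assms(1)] w by simp
qed

lemma cayley_dist_vertices:
  assumes "g \<in> carrier G" "h \<in> carrier G"
  shows "cayley_dist G S (Vertex g) (Vertex h) = real (wdist G S g h)"
  using cayley_dist_le[OF pl_path_vertices[OF assms]]
    cayley_dist_ge[OF pl_path_vertices[OF assms] pl_path_vertices_ge[OF assms]] by simp

lemma cayley_length_vertex:
  "g \<in> carrier G \<Longrightarrow> cayley_length G S (Vertex g) = real (wlen G S g)"
  by (simp add: cayley_length_def cayley_dist_vertices wdist_def)

text \<open>If both endpoints of an edge have length \<open>n\<close>, then its midpoint has length \<open>n + 1/2\<close>;
  this case has to be excluded.\<close>

lemma cayley_edge_in_ball: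
  assumes "g \<in> carrier G" "a \<in> S" "wlen G S g \<le> n" "wlen G S (g \<otimes> a) \<le> n"
    "wlen G S g + wlen G S (g \<otimes> a) < 2 * n"
  shows "cayley_edge G g a \<subseteq> cayley_ball G S (real n)"
proof
  fix p assume "p \<in> cayley_edge G g a"
  then obtain t where t: "t \<in> {0..1}" "p = edge_point G g a t" by (auto simp: cayley_edge_def)
  have a: "a \<in> carrier G" using assms S_sub by auto
  have 1: "pl_path G S (Vertex \<one>) p (real (wlen G S g) + t)"
  proof -
    have "pl_path G S (Vertex g) p t"
      using pl_path_edge[OF assms(1,2), of 0 t] t by simp
    then show ?thesis using pl_path_trans[OF pl_path_vertices[OF one_closed assms(1)]] assms(1)
      by (simp add: wdist_def)
  qed
  have 2: "pl_path G S (Vertex \<one>) p (real (wlen G S (g \<otimes> a)) + (1 - t))"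
  proof -
    have "pl_path G S (Vertex (g \<otimes> a)) p (1 - t)"
      using pl_path_edge[OF assms(1,2), of 1 t] t by simp
    then show ?thesis using pl_path_trans[OF pl_path_vertices[OF one_closed]] assms(1) a
      by (simp add: wdist_def)
  qed
  have "wlen G S g + 1 \<le> n \<or> wlen G S (g \<otimes> a) + 1 \<le> n" using assms by linarith
  then have "cayley_length G S p \<le> real n"
    using cayley_dist_le[OF 1] cayley_dist_le[OF 2] t unfolding cayley_length_def by auto
  then show "p \<in> cayley_ball G S (real n)"
    using edge_point_in_graph assms t by (simp add: cayley_ball_def)
qed

section \<open>Words as unit speed paths in the realization\<close>

definition geod_path :: "'a \<Rightarrow> 'a list \<Rightarrow> real \<Rightarrow> 'a cayley_point" where
  "geod_path g w t = (let k = nat \<lfloor>t\<rfloor> in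
     if k < length w then edge_point G (g \<otimes> wprod G (take k w)) (w ! k) (t - real k)
     else Vertex (g \<otimes> wprod G w))"

lemma take_lists: "w \<in> lists S \<Longrightarrow> take k w \<in> lists S"
  by (auto dest: in_set_takeD)

lemma drop_lists: "w \<in> lists S \<Longrightarrow> drop k w \<in> lists S"
  by (auto dest: in_set_dropD)

lemma wprod_take_Suc:
  assumes "w \<in> lists S" "g \<in> carrier G" "k < length w"
  shows "g \<otimes> wprod G (take (Suc k) w) = g \<otimes> wprod G (take k w) \<otimes> w ! k"
proof -
  have "w ! k \<in> S" using assms by auto
  then have "w ! k \<in> carrier G" using S_sub by auto
  moreover have "wprod G (take k w @ [w ! k]) = wprod G (take k w) \<otimes> wprod G [w ! k]"
    by (rule wprod_append_lists) (use assms take_lists \<open>w ! k \<in> S\<close> in auto)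
  ultimately show ?thesis
    using assms wprod_lists[OF take_lists[OF assms(1), of k]]
    by (simp add: take_Suc_conv_app_nth m_assoc)
qed

lemma geod_path_nat:
  assumes "k \<le> length w"
  shows "geod_path g w (real k) = Vertex (g \<otimes> wprod G (take k w))"
  using assms by (auto simp: geod_path_def Let_def)

text \<open>At the right end of the closed interval the floor already selects the next edge, or the
  final vertex; both agree with the end of the present edge.\<close>

lemma geod_path_edge:
  assumes "w \<in> lists S" "g \<in> carrier G" "k < length w" "real k \<le> t" "t \<le> real k + 1"
  shows "geod_path g w t = edge_point G (g \<otimes> wprod G (take k w)) (w ! k) (t - real k)"
proof (cases "t = real k + 1")
  case True
  then have "geod_path g w t = Vertex (g \<otimes> wprod G (take (Suc k) w))"
    using geod_path_nat[of "Suc k" w g] assms(3) by (simp add: add.commute)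
  then show ?thesis using True wprod_take_Suc[OF assms(1-3)] by simp
next
  case False
  then have "nat \<lfloor>t\<rfloor> = k" using assms by linarith
  then show ?thesis using assms by (simp add: geod_path_def)
qed

lemma geod_path_pl_edge:
  assumes "w \<in> lists S" "g \<in> carrier G" "k < length w" "real k \<le> s" "s \<le> real k + 1"
    "real k \<le> t" "t \<le> real k + 1"
  shows "pl_path G S (geod_path g w s) (geod_path g w t) \<bar>s - t\<bar>"
proof -
  have "w ! k \<in> S" "g \<otimes> wprod G (take k w) \<in> carrier G"
    using assms wprod_lists[OF take_lists[OF assms(1), of k]] by auto
  from pl_path_edge[OF this(2,1), of "s - real k" "t - real k"] show ?thesis
    using geod_path_edge[OF assms(1-3)] assms by simp
qed

lemma geod_path_pl_nat:
  assumes "w \<in> lists S" "g \<in> carrier G" "i \<le> j" "j \<le> length w"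
  shows "pl_path G S (geod_path g w (real i)) (geod_path g w (real j)) (real (j - i))"
  using assms(3,4)
proof (induction j rule: dec_induct)
  case base
  then have "g \<otimes> wprod G (take i w) \<in> carrier G"
    using assms wprod_lists[OF take_lists[OF assms(1), of i]] by simp
  then show ?case using geod_path_nat[of i w g] base pl_refl[OF Vertex_in_graph] by simp
next
  case (step j)
  have "pl_path G S (geod_path g w (real j)) (geod_path g w (real (Suc j))) 1"
    using geod_path_pl_edge[OF assms(1,2), of j "real j" "real (Suc j)"] step by simp
  from pl_path_trans[OF step.IH this] step show ?case
    by (simp add: Suc_diff_le add.commute)
qed

lemma geod_path_pl:
  assumes w: "w \<in> lists S" "g \<in> carrier G" and st: "0 \<le> s" "s \<le> t" "t \<le> real (length w)"
  shows "pl_path G S (geod_path g w s) (geod_path g w t) (t - s)"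
proof -
  define i where "i = nat \<lfloor>s\<rfloor>"
  have i: "real i \<le> s" "s < real i + 1" using st by (auto simp: i_def)
  show ?thesis
  proof (cases "i < length w")
    case False
    then have "s = real (length w)" "t = real (length w)" using i st by linarith+
    then show ?thesis using geod_path_pl_nat[OF w, of "length w" "length w"] by simp
  next
    case iw: True
    show ?thesis
    proof (cases "t \<le> real i + 1")
      case True
      then show ?thesis using geod_path_pl_edge[OF w iw, of s t] i st by simp
    next
      case False
      define j where "j = nat \<lfloor>t\<rfloor>"
      have j: "real j \<le> t" "t < real j + 1" "j \<le> length w" "Suc i \<le> j"
        using st False unfolding j_def by linarith+
      have 1: "pl_path G S (geod_path g w s) (geod_path g w (real (Suc i))) (real (Suc i) - s)"
        using geod_path_pl_edge[OF w iw, of s "real (Suc i)"] i by simp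
      have 2: "pl_path G S (geod_path g w (real (Suc i))) (geod_path g w (real j)) (real (j - Suc i))"
        by (rule geod_path_pl_nat[OF w j(4,3)])
      have 3: "pl_path G S (geod_path g w (real j)) (geod_path g w t) (t - real j)"
      proof (cases "j < length w")
        case True
        then show ?thesis using geod_path_pl_edge[OF w True, of "real j" t] j by simp
      next
        case False
        then have "j = length w" "t = real j" using j st by linarith+
        then show ?thesis using geod_path_pl_nat[OF w, of j j] by simp
      qed
      have "(real (Suc i) - s) + real (j - Suc i) + (t - real j) = t - s"
        using j by (simp add: of_nat_diff)
      then show ?thesis using pl_path_trans[OF pl_path_trans[OF 1 2] 3] by simp
    qed
  qed
qed

text \<open>A path between the two points that is shorter than \<open>t - s\<close> could be
  completed by the initial and final pieces of \<open>w\<close> to a path between the end vertices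
  that is shorter than their word distance.\<close>

lemma geod_path_dist:
  assumes w: "w \<in> lists S" "g \<in> carrier G" and geo: "wlen G S (wprod G w) = length w"
    and st: "0 \<le> s" "s \<le> t" "t \<le> real (length w)"
  shows "cayley_dist G S (geod_path g w s) (geod_path g w t) = t - s"
proof (rule antisym)
  show "cayley_dist G S (geod_path g w s) (geod_path g w t) \<le> t - s"
    by (rule cayley_dist_le[OF geod_path_pl[OF w st]])
  show "t - s \<le> cayley_dist G S (geod_path g w s) (geod_path g w t)"
  proof (rule cayley_dist_ge[OF geod_path_pl[OF w st]])
    fix l assume l: "pl_path G S (geod_path g w s) (geod_path g w t) l"
    have "pl_path G S (geod_path g w 0) (geod_path g w s) (s - 0)"
      "pl_path G S (geod_path g w t) (geod_path g w (real (length w))) (real (length w) - t)"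
      using geod_path_pl[OF w, of 0 s] geod_path_pl[OF w, of t "real (length w)"] st by simp_all
    then have "pl_path G S (geod_path g w 0) (geod_path g w (real (length w))) (s + l + (real (length w) - t))"
      using pl_path_trans[OF pl_path_trans[OF _ l]] by fastforce
    then have p: "pl_path G S (Vertex g) (Vertex (g \<otimes> wprod G w)) (s + l + (real (length w) - t))"
      using geod_path_nat[of 0 w g] geod_path_nat[of "length w" w g] w by simp
    have "real (length w) \<le> s + l + (real (length w) - t)"
      using pl_path_vertices_ge[OF w(2) _ p] wdist_mult_right[OF w(2)] w geo by simp
    then show "t - s \<le> l" by simp
  qed
qed

lemma geod_path_in_graph:
  assumes "w \<in> lists S" "g \<in> carrier G" "0 \<le> t" "t \<le> real (length w)"
  shows "geod_path g w t \<in> cayley_graph G S"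
proof (cases "nat \<lfloor>t\<rfloor> < length w")
  case True
  have "w ! nat \<lfloor>t\<rfloor> \<in> S" "g \<otimes> wprod G (take (nat \<lfloor>t\<rfloor>) w) \<in> carrier G"
    using assms True wprod_lists[OF take_lists[OF assms(1)]] by auto
  moreover have "t - real (nat \<lfloor>t\<rfloor>) \<in> {0..1}" using assms by simp linarith
  ultimately have "edge_point G (g \<otimes> wprod G (take (nat \<lfloor>t\<rfloor>) w)) (w ! nat \<lfloor>t\<rfloor>) (t - real (nat \<lfloor>t\<rfloor>))
      \<in> cayley_graph G S"
    by (intro edge_point_in_graph)
  then show ?thesis using True unfolding geod_path_def Let_def by (simp only: if_True)
next
  case False
  then show ?thesis using assms Vertex_in_graph by (simp add: geod_path_def)
qed

lemma geodesic_segment_word: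
  assumes w: "w \<in> lists S" "g \<in> carrier G" and geo: "wlen G S (wprod G w) = length w"
  shows "geodesic_segment G S (Vertex g) (Vertex (g \<otimes> wprod G w)) (geod_path g w ` {0..real (length w)})"
  unfolding geodesic_segment_def
proof (intro exI[of _ "geod_path g w"] exI[of _ "real (length w)"] conjI ballI)
  show "geod_path g w ` {0..real (length w)} \<subseteq> cayley_graph G S"
    using geod_path_in_graph[OF w] by auto
  show "geod_path g w 0 = Vertex g" "geod_path g w (real (length w)) = Vertex (g \<otimes> wprod G w)"
    using geod_path_nat[of 0 w g] geod_path_nat[of "length w" w g] w by auto
  have sym: "cayley_dist G S x y = cayley_dist G S y x" for x y
    unfolding cayley_dist_def using pl_path_sym by (intro arg_cong[where f=Inf]) blast
  show "cayley_dist G S (geod_path g w s) (geod_path g w t) = \<bar>s - t\<bar>"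
    if "s \<in> {0..real (length w)}" "t \<in> {0..real (length w)}" for s t
    using geod_path_dist[OF w geo, of s t] geod_path_dist[OF w geo, of t s] that sym
    by (cases "s \<le> t") auto
qed auto

section \<open>From thin triangles of the realization to thin triangles of vertices\<close>

lemma geod_path_nbhd:
  fixes e :: real
  assumes u: "u \<in> lists S" "g \<in> carrier G" and v: "v \<in> lists S" "h \<in> carrier G"
    and i: "i \<le> length u"
    and q: "t \<in> {0..real (length v)}"
      "cayley_dist G S (geod_path g u (real i)) (geod_path h v t) \<le> e"
  shows "\<exists>j\<le>length v. real (wdist G S (g \<otimes> wprod G (take i u)) (h \<otimes> wprod G (take j v))) < e + 2"
proof -
  let ?x = "g \<otimes> wprod G (take i u)"
  define j where "j = nat \<lfloor>t\<rfloor>"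
  let ?y = "h \<otimes> wprod G (take j v)"
  have j: "real j \<le> t" "t \<le> real j + 1" "j \<le> length v"
    using q unfolding j_def by auto linarith+
  have x: "geod_path g u (real i) = Vertex ?x" "?x \<in> carrier G"
    using geod_path_nat[OF i] u wprod_lists[OF take_lists[OF u(1), of i]] by auto
  have y: "geod_path h v (real j) = Vertex ?y" "?y \<in> carrier G"
    using geod_path_nat[OF j(3)] v wprod_lists[OF take_lists[OF v(1), of j]] by auto
  have yt: "pl_path G S (Vertex ?y) (geod_path h v t) (t - real j)"
    using geod_path_pl[OF v, of "real j" t] j q y by simp
  let ?L = "{l. pl_path G S (Vertex ?x) (geod_path h v t) l}"
  have "?L \<noteq> {}" using pl_path_trans[OF pl_path_vertices[OF x(2) y(2)] yt] by blast
  \<comment> \<open>One unit of slack turns the infimum into an actual path, and a second unit pays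
    for rounding \<open>t\<close> down to a vertex. This is the source of
    \<open>e + 2\<close>.\<close>
  moreover have "Inf ?L < e + 1" using q(2) x by (simp add: cayley_dist_def)
  ultimately obtain l where "l < e + 1" "pl_path G S (Vertex ?x) (geod_path h v t) l"
    using cInf_lessD[of ?L "e + 1"] by auto
  then have "real (wdist G S ?x ?y) \<le> l + (t - real j)"
    using pl_path_vertices_ge[OF x(2) y(2)] pl_path_trans pl_path_sym[OF yt] by blast
  then have "real (wdist G S ?x ?y) < e + 2" using \<open>l < e + 1\<close> j by linarith
  then show ?thesis using j by blast
qed

lemma disc_geod_word:
  assumes p: "disc_geod (carrier G) (wdist G S) L p"
  obtains w where "w \<in> lists S" "length w = L" "wlen G S (wprod G w) = L"
    "\<And>i. i \<le> L \<Longrightarrow> p 0 \<otimes> wprod G (take i w) = p i"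
proof -
  define w where "w = map (\<lambda>i. inv p i \<otimes> p (Suc i)) [0..<L]"
  have pC: "p i \<in> carrier G" if "i \<le> L" for i using p that unfolding disc_geod_def by blast
  have "inv p i \<otimes> p (Suc i) \<in> S" if "i < L" for i
  proof -
    have "wdist G S (p i) (p (Suc i)) = 1" using p that unfolding disc_geod_def by simp
    then show ?thesis using wlen_eq_1 pC that by (simp add: wdist_def)
  qed
  then have w: "w \<in> lists S" by (auto simp: w_def)
  have p_eq: "p 0 \<otimes> wprod G (take i w) = p i" if "i \<le> L" for i
    using that
  proof (induction i)
    case 0
    then show ?case using pC by simp
  next
    case (Suc i)
    then have "p 0 \<otimes> wprod G (take (Suc i) w) = p i \<otimes> (inv p i \<otimes> p (Suc i))"
      using wprod_take_Suc[OF w pC[of 0], of i] by (simp add: w_def)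
    then show ?case using pC Suc.prems by (simp flip: m_assoc)
  qed
  have wL: "length w = L" by (simp add: w_def)
  have "wlen G S (wprod G w) = wdist G S (p 0) (p 0 \<otimes> wprod G w)"
    using wdist_mult_right[OF pC[of 0]] w by simp
  also have "\<dots> = wdist G S (p 0) (p L)" using p_eq[of L] wL by simp
  also have "\<dots> = L" using p unfolding disc_geod_def by simp
  finally show ?thesis using that w p_eq wL by blast
qed

text \<open>Discrete geodesics are realized by words, thinness is applied in the realization, and
  \<open>geod_path_nbhd\<close> returns to vertices at the cost of 2. A negative \<open>e\<close> is
  rounded up to 0 by \<open>nat\<close>.\<close>

lemma disc_hyperbolic:
  assumes thin: "thin_triangles G S e"
  shows "disc_hyperbolic (carrier G) (wdist G S) (nat \<lceil>e\<rceil> + 2)"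
proof
  fix x y assume xy: "x \<in> carrier G" "y \<in> carrier G"
  have "inv x \<otimes> y \<in> carrier G" using xy by simp
  then obtain w where w: "w \<in> lists S" "length w = wdist G S x y" "wprod G w = inv x \<otimes> y"
    using ex_geodesic_word wdist_def by metis
  define p where "p i = x \<otimes> wprod G (take i w)" for i
  have C: "wprod G (take i w) \<in> carrier G" for i using take_lists[OF w(1)] by simp
  have "disc_geod (carrier G) (wdist G S) (wdist G S x y) p"
    unfolding disc_geod_def
  proof (intro conjI allI impI)
    fix i j assume ij: "i \<le> j" "j \<le> wdist G S x y"
    define u where "u = drop i (take j w)"
    have u: "u \<in> lists S" "length u = j - i" using ij w take_lists drop_lists by (auto simp: u_def)
    have "take j w = take i w @ u" using ij unfolding u_def
      by (metis append_take_drop_id min.absorb1 take_take)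
    then have tj: "wprod G (take j w) = wprod G (take i w) \<otimes> wprod G u"
      using wprod_append_lists[OF take_lists[OF w(1)] u(1)] by simp
    have ge: "wdist G S (p i) (p j) = wlen G S (wprod G u)"
      unfolding p_def tj using wdist_mult_right[of "x \<otimes> wprod G (take i w)" "wprod G u"] xy C u
      by (simp add: m_assoc del: in_lists_conv_set)
    \<comment> \<open>Subwords of a geodesic word are geodesic: a shorter spelling of
      \<open>u\<close> would shorten \<open>w\<close>.\<close>
    have "w = take i w @ u @ drop j w" using \<open>take j w = take i w @ u\<close>
      by (metis append.assoc append_take_drop_id)
    then have "wprod G w = wprod G (take i w) \<otimes> (wprod G u \<otimes> wprod G (drop j w))"
      using wprod_append_lists[OF take_lists[OF w(1)], of "u @ drop j w" i]
        wprod_append_lists[OF u(1) drop_lists[OF w(1), of j]] u drop_lists[OF w(1), of j] by simp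
    then have "wlen G S (wprod G w) \<le> wlen G S (wprod G (take i w)) + (wlen G S (wprod G u) + wlen G S (wprod G (drop j w)))"
      using wlen_mult[OF C, of "wprod G u \<otimes> wprod G (drop j w)" i]
        wlen_mult[of "wprod G u" "wprod G (drop j w)"] u(1) drop_lists[OF w(1)] by simp
    also have "\<dots> \<le> i + (wlen G S (wprod G u) + (length w - j))"
      using wlen_le[OF take_lists[OF w(1)], of i] wlen_le[OF drop_lists[OF w(1)], of j] by simp
    finally have "j - i \<le> wlen G S (wprod G u)" using w ij by (simp add: wdist_def)
    then show "wdist G S (p i) (p j) = j - i" using ge wlen_le[OF u(1)] u(2) by simp
  qed (use xy C in \<open>simp add: p_def\<close>)
  moreover have "p 0 = x" "p (wdist G S x y) = y"
    using xy w(2,3) by (simp_all add: p_def m_assoc[symmetric])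
  ultimately show "\<exists>p. disc_geod (carrier G) (wdist G S) (wdist G S x y) p \<and> p 0 = x \<and> p (wdist G S x y) = y"
    by blast
next
  fix A B C p q r i
  assume pqr: "disc_geod (carrier G) (wdist G S) A p" "disc_geod (carrier G) (wdist G S) B q"
    "disc_geod (carrier G) (wdist G S) C r"
    and ends: "p A = q 0" "q B = r 0" "r C = p 0" and i: "i \<le> A"
  obtain u where u: "u \<in> lists S" "length u = A" "wlen G S (wprod G u) = A"
    "\<And>i. i \<le> A \<Longrightarrow> p 0 \<otimes> wprod G (take i u) = p i" using disc_geod_word[OF pqr(1)] by blast
  obtain v where v: "v \<in> lists S" "length v = B" "wlen G S (wprod G v) = B"
    "\<And>i. i \<le> B \<Longrightarrow> q 0 \<otimes> wprod G (take i v) = q i" using disc_geod_word[OF pqr(2)] by blast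
  obtain w where w: "w \<in> lists S" "length w = C" "wlen G S (wprod G w) = C"
    "\<And>i. i \<le> C \<Longrightarrow> r 0 \<otimes> wprod G (take i w) = r i" using disc_geod_word[OF pqr(3)] by blast
  have C: "p 0 \<in> carrier G" "q 0 \<in> carrier G" "r 0 \<in> carrier G"
    using pqr unfolding disc_geod_def by auto
  have "geodesic_segment G S (Vertex (p 0)) (Vertex (q 0)) (geod_path (p 0) u ` {0..real A})"
    "geodesic_segment G S (Vertex (q 0)) (Vertex (r 0)) (geod_path (q 0) v ` {0..real B})"
    "geodesic_segment G S (Vertex (r 0)) (Vertex (p 0)) (geod_path (r 0) w ` {0..real C})"
    using geodesic_segment_word[OF u(1) C(1)] geodesic_segment_word[OF v(1) C(2)]
      geodesic_segment_word[OF w(1) C(3)] u v w ends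
      u(4)[of A] v(4)[of B] w(4)[of C] by auto
  then have "geod_path (p 0) u ` {0..real A} \<subseteq>
      cayley_nbhd G S e (geod_path (q 0) v ` {0..real B} \<union> geod_path (r 0) w ` {0..real C})"
    using thin unfolding thin_triangles_def by blast
  then have "geod_path (p 0) u (real i) \<in>
      cayley_nbhd G S e (geod_path (q 0) v ` {0..real B} \<union> geod_path (r 0) w ` {0..real C})"
    using i by auto
  then consider t where "t \<in> {0..real B}" "cayley_dist G S (geod_path (p 0) u (real i)) (geod_path (q 0) v t) \<le> e"
    | t where "t \<in> {0..real C}" "cayley_dist G S (geod_path (p 0) u (real i)) (geod_path (r 0) w t) \<le> e"
    unfolding cayley_nbhd_def by blast
  then show "(\<exists>j\<le>B. wdist G S (p i) (q j) \<le> nat \<lceil>e\<rceil> + 2) \<or> (\<exists>j\<le>C. wdist G S (p i) (r j) \<le> nat \<lceil>e\<rceil> + 2)"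
  proof cases
    case 1
    from geod_path_nbhd[OF u(1) C(1) v(1) C(2) _ _ 1(2)] 1 i u v
    obtain j where "j \<le> B" "real (wdist G S (p i) (q j)) < e + 2" by auto
    then have "wdist G S (p i) (q j) \<le> nat \<lceil>e\<rceil> + 2" by linarith
    then show ?thesis using \<open>j \<le> B\<close> by blast
  next
    case 2
    from geod_path_nbhd[OF u(1) C(1) w(1) C(3) _ _ 2(2)] 2 i u w
    obtain j where "j \<le> C" "real (wdist G S (p i) (r j)) < e + 2" by auto
    then have "wdist G S (p i) (r j) \<le> nat \<lceil>e\<rceil> + 2" by linarith
    then show ?thesis using \<open>j \<le> C\<close> by blast
  qed
qed (use wdist_self wdist_sym wdist_triangle in auto)

end

section \<open>Dickson's lemma and common descent\<close>

text \<open>Induction on the coordinates. A finite set that dominates for the coordinates in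
  \<open>I\<close> also works for the new coordinate once that is at least the bound
  \<open>B\<close>; each of the finitely many smaller values gives a slice in which the new
  coordinate is constant.\<close>

lemma dickson:
  fixes \<phi> :: "'i \<Rightarrow> 'x \<Rightarrow> nat"
  assumes "finite I"
  shows "\<exists>F\<subseteq>P. finite F \<and> (\<forall>x\<in>P. \<exists>y\<in>F. \<forall>i\<in>I. \<phi> i y \<le> \<phi> i x)"
  using assms
proof (induction I arbitrary: P)
  case empty
  show ?case
  proof (cases "P = {}")
    case False
    then obtain y where "y \<in> P" by blast
    then show ?thesis by (intro exI[of _ "{y}"]) auto
  qed auto
next
  case (insert i I)
  obtain F0 where F0: "F0 \<subseteq> P" "finite F0" "\<forall>x\<in>P. \<exists>y\<in>F0. \<forall>i\<in>I. \<phi> i y \<le> \<phi> i x"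
    using insert.IH by blast
  obtain B where B: "\<And>y. y \<in> F0 \<Longrightarrow> \<phi> i y \<le> B"
    using finite_imageI[OF F0(2), of "\<phi> i"] by (meson Max_ge imageI)
  have "\<forall>k. \<exists>F\<subseteq>{x\<in>P. \<phi> i x = k}. finite F \<and> (\<forall>x\<in>{x\<in>P. \<phi> i x = k}. \<exists>y\<in>F. \<forall>i\<in>I. \<phi> i y \<le> \<phi> i x)"
    using insert.IH by blast
  from choice[OF this] obtain F where F: "\<forall>k. F k \<subseteq> {x\<in>P. \<phi> i x = k} \<and> finite (F k) \<and>
      (\<forall>x\<in>{x\<in>P. \<phi> i x = k}. \<exists>y\<in>F k. \<forall>i\<in>I. \<phi> i y \<le> \<phi> i x)" by blast
  have F3: "\<exists>y\<in>F (\<phi> i x). \<forall>i\<in>I. \<phi> i y \<le> \<phi> i x" if "x \<in> P" for x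
    using F[rule_format, of "\<phi> i x"] that by simp
  show ?case
  proof (intro exI[of _ "F0 \<union> (\<Union>k<B. F k)"] conjI ballI)
    show "F0 \<union> (\<Union>k<B. F k) \<subseteq> P" using F0(1) F by blast
    show "finite (F0 \<union> (\<Union>k<B. F k))" using F0(2) F by blast
    fix x assume x: "x \<in> P"
    show "\<exists>y\<in>F0 \<union> (\<Union>k<B. F k). \<forall>i\<in>insert i I. \<phi> i y \<le> \<phi> i x"
    proof (cases "\<phi> i x < B")
      case True
      obtain y where "y \<in> F (\<phi> i x)" "\<forall>i\<in>I. \<phi> i y \<le> \<phi> i x" using F3[OF x] by blast
      moreover from this have "\<phi> i y = \<phi> i x" using F by blast
      ultimately show ?thesis using True by (intro bexI[of _ y]) auto
    next
      case False
      obtain y where "y \<in> F0" "\<forall>i\<in>I. \<phi> i y \<le> \<phi> i x" using F0(3) x by blast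
      moreover from this have "\<phi> i y \<le> \<phi> i x" using B False by force
      ultimately show ?thesis by (intro bexI[of _ y]) auto
    qed
  qed
qed

context group
begin

text \<open>Letters of a commuting alphabet can be reordered, so a sub-multiset of the letters can
  be moved to the front.\<close>

lemma split_off:
  assumes Z: "Z \<subseteq> carrier G" "\<And>x y. x \<in> Z \<Longrightarrow> y \<in> Z \<Longrightarrow> x \<otimes> y = y \<otimes> x"
    and zs: "zs \<in> lists Z" and sub: "mset ms \<subseteq># mset zs"
  obtains ks where "ks \<in> lists Z" "length zs = length ms + length ks"
    "wprod G zs = wprod G ms \<otimes> wprod G ks"
proof -
  obtain ks where ks: "mset ks = mset zs - mset ms" using ex_mset by blast
  have m: "mset zs = mset (ms @ ks)" using sub ks by simp
  have s: "set zs = set (ms @ ks)" using m mset_eq_setD by blast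
  have zsZ: "set zs \<subseteq> Z" using zs by auto
  have C: "set ms \<subseteq> carrier G" "set ks \<subseteq> carrier G" using s zsZ Z by auto
  have "wprod G zs = wprod G (ms @ ks)"
  proof (rule wprod_perm[OF m])
    show "set zs \<subseteq> carrier G" using zsZ Z(1) by blast
    show "x \<otimes> y = y \<otimes> x" if "x \<in> set zs" "y \<in> set zs" for x y
      using Z(2) zsZ that by blast
  qed
  moreover have "length zs = length ms + length ks" using m by (metis length_append size_mset)
  moreover have "ks \<in> lists Z" using s zsZ by auto
  ultimately show ?thesis using that wprod_append[OF C] by simp
qed

text \<open>The pairs of words \<open>(zs, zs')\<close> with \<open>e zs = zs'\<close> form a subset of some \<open>\<nat>\<^sup>k\<close>; dividing by a
  minimal pair below \<open>(zs, zs')\<close> leaves two words for the same element.\<close>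

lemma common_descent:
  assumes Z: "finite Z" "Z \<subseteq> carrier G" "\<And>x y. x \<in> Z \<Longrightarrow> y \<in> Z \<Longrightarrow> x \<otimes> y = y \<otimes> x"
    and e: "e \<in> carrier G"
  shows "\<exists>B. \<forall>zs\<in>lists Z. \<forall>zs'\<in>lists Z. e \<otimes> wprod G zs = wprod G zs' \<longrightarrow>
    (\<exists>ms\<in>lists Z. \<exists>ms'\<in>lists Z. \<exists>ks\<in>lists Z. \<exists>ks'\<in>lists Z.
      length ms \<le> B \<and> length ms' \<le> B \<and>
      length zs = length ms + length ks \<and> length zs' = length ms' + length ks' \<and>
      wprod G zs = wprod G ms \<otimes> wprod G ks \<and> wprod G zs' = wprod G ms' \<otimes> wprod G ks' \<and>
      wprod G ks = wprod G ks')"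
proof -
  define P where "P = {(zs, zs'). zs \<in> lists Z \<and> zs' \<in> lists Z \<and> e \<otimes> wprod G zs = wprod G zs'}"
  \<comment> \<open>The coordinates of a pair are the multiplicities of the letters; the boolean
    selects the word in which they are counted.\<close>
  define \<phi> where "\<phi> = (\<lambda>(b, z) (zs, zs'). count (mset (if b then zs else zs')) (z::'a))"
  have fin: "finite (UNIV \<times> Z :: (bool \<times> 'a) set)" using Z by simp
  obtain F where F: "F \<subseteq> P" "finite F" "\<forall>x\<in>P. \<exists>y\<in>F. \<forall>i\<in>UNIV \<times> Z. \<phi> i y \<le> \<phi> i x"
    using dickson[OF fin, of P \<phi>] by (elim exE conjE) (rule that)
  obtain B where B: "\<And>y. y \<in> F \<Longrightarrow> length (fst y) + length (snd y) \<le> B"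
    using finite_imageI[OF F(2), of "\<lambda>y. length (fst y) + length (snd y)"] by (meson Max_ge imageI)
  show ?thesis
  proof (intro exI[of _ B] ballI impI)
    fix zs zs' assume zs: "zs \<in> lists Z" "zs' \<in> lists Z" "e \<otimes> wprod G zs = wprod G zs'"
    then have "(zs, zs') \<in> P" by (simp add: P_def)
    then obtain ms ms' where y: "(ms, ms') \<in> F" "\<forall>i\<in>UNIV \<times> Z. \<phi> i (ms, ms') \<le> \<phi> i (zs, zs')"
      using F(3) by (metis surj_pair)
    have ms: "ms \<in> lists Z" "ms' \<in> lists Z" "e \<otimes> wprod G ms = wprod G ms'"
      using y(1) F(1) by (auto simp: P_def)
    have "mset ms \<subseteq># mset zs" "mset ms' \<subseteq># mset zs'"
    proof -
      have "count (mset ms) z \<le> count (mset zs) z \<and> count (mset ms') z \<le> count (mset zs') z" for z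
      proof (cases "z \<in> Z")
        case True
        then show ?thesis using y(2)[THEN bspec, of "(True, z)"] y(2)[THEN bspec, of "(False, z)"]
          by (simp add: \<phi>_def)
      next
        case False
        then have "z \<notin> set ms" "z \<notin> set ms'" using ms by auto
        then have "count (mset ms) z = 0" "count (mset ms') z = 0"
          by (simp_all add: count_eq_zero_iff)
        then show ?thesis by (metis le0)
      qed
      then show "mset ms \<subseteq># mset zs" "mset ms' \<subseteq># mset zs'" by (simp_all add: mset_subset_eqI)
    qed
    note sub = this
    obtain ks where ks: "ks \<in> lists Z" "length zs = length ms + length ks"
      "wprod G zs = wprod G ms \<otimes> wprod G ks"
      using split_off[OF Z(2,3) zs(1) sub(1)] .
    obtain ks' where ks': "ks' \<in> lists Z" "length zs' = length ms' + length ks'"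
      "wprod G zs' = wprod G ms' \<otimes> wprod G ks'"
      using split_off[OF Z(2,3) zs(2) sub(2)] .
    have C: "wprod G ws \<in> carrier G" if "ws \<in> lists Z" for ws
    proof -
      have "set ws \<subseteq> carrier G" using that Z(2) by auto
      then show ?thesis by simp
    qed
    \<comment> \<open>Both pairs satisfy the same equation with \<open>e\<close>, so dividing one
      equation by the other removes \<open>e\<close>.\<close>
    have "wprod G ms' \<otimes> wprod G ks = e \<otimes> wprod G ms \<otimes> wprod G ks" using ms by simp
    also have "\<dots> = wprod G ms' \<otimes> wprod G ks'"
      using zs(3) ks(3) ks'(3) e C[OF ms(1)] C[OF ks(1)] by (simp add: m_assoc)
    finally have "wprod G ks = wprod G ks'" using C[OF ms(2)] C[OF ks(1)] C[OF ks'(1)] by simp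
    moreover have "length ms \<le> B" "length ms' \<le> B" using B[OF y(1)] by auto
    ultimately show "\<exists>ms\<in>lists Z. \<exists>ms'\<in>lists Z. \<exists>ks\<in>lists Z. \<exists>ks'\<in>lists Z.
      length ms \<le> B \<and> length ms' \<le> B \<and>
      length zs = length ms + length ks \<and> length zs' = length ms' + length ks' \<and>
      wprod G zs = wprod G ms \<otimes> wprod G ks \<and> wprod G zs' = wprod G ms' \<otimes> wprod G ks' \<and>
      wprod G ks = wprod G ks'"
      using ms ks ks' by blast
  qed
qed

end

section \<open>Edge paths inside a ball\<close>

context cayley
begin

text \<open>Edges that lie in the ball of radius \<open>n\<close> together with their interior; the
  strict inequality excludes edges with both ends on the sphere. As a relation its powers encode
  edge paths of a given length.\<close>

definition ball_steps :: "nat \<Rightarrow> ('a \<times> 'a) set" where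
  "ball_steps n = {(x, y). x \<in> carrier G \<and> (\<exists>a\<in>S. y = x \<otimes> a) \<and>
     wlen G S x \<le> n \<and> wlen G S y \<le> n \<and> wlen G S x + wlen G S y < 2 * n}"

lemma sym_ball_steps: "sym (ball_steps n)"
proof (rule symI)
  fix x y assume "(x, y) \<in> ball_steps n"
  then obtain a where xy: "x \<in> carrier G" "a \<in> S" "y = x \<otimes> a"
    "wlen G S x \<le> n" "wlen G S y \<le> n" "wlen G S x + wlen G S y < 2 * n" by (auto simp: ball_steps_def)
  have a: "a \<in> carrier G" using xy S_sub by blast
  have "x = y \<otimes> inv a" unfolding xy(3) using xy(1) a by (simp add: m_assoc)
  then have "\<exists>b\<in>S. x = y \<otimes> b" using S_inv[OF xy(2)] by blast
  moreover have "y \<in> carrier G" unfolding xy(3) using xy(1) a by simp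
  ultimately show "(y, x) \<in> ball_steps n"
    using xy(4-6) unfolding ball_steps_def by (simp add: add.commute)
qed

lemma ball_steps_pow_sym: "(x, y) \<in> ball_steps n ^^ k \<Longrightarrow> (y, x) \<in> ball_steps n ^^ k"
proof (induction k arbitrary: y)
  case (Suc k)
  then obtain z where "(x, z) \<in> ball_steps n ^^ k" "(z, y) \<in> ball_steps n" by auto
  then show ?case using Suc.IH sym_ball_steps by (meson relpow_Suc_I2 symD)
qed simp

text \<open>Length grows by at most 1 per letter, so before each letter the path is still at length
  less than \<open>n\<close>, and the strict condition on the edge holds.\<close>

lemma ball_steps_up:
  "w \<in> lists S \<Longrightarrow> x \<in> carrier G \<Longrightarrow> wlen G S x + length w \<le> n \<Longrightarrow>
    (x, x \<otimes> wprod G w) \<in> ball_steps n ^^ length w"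
proof (induction w arbitrary: x)
  case (Cons a w)
  then have a: "a \<in> S" "a \<in> carrier G" "w \<in> lists S" using S_sub by auto
  have "wlen G S (x \<otimes> a) \<le> wlen G S x + 1"
    using wlen_mult[of x a] wlen_gen[OF a(1)] a Cons.prems by simp
  then have "(x, x \<otimes> a) \<in> ball_steps n" "wlen G S (x \<otimes> a) + length w \<le> n"
    using a Cons.prems by (auto simp: ball_steps_def)
  moreover from this have "(x \<otimes> a, x \<otimes> a \<otimes> wprod G w) \<in> ball_steps n ^^ length w"
    using Cons a by simp
  ultimately have "(x, x \<otimes> a \<otimes> wprod G w) \<in> ball_steps n ^^ Suc (length w)"
    by (metis relpow_Suc_I2)
  then show ?case using Cons.prems a by (simp add: m_assoc del: in_lists_conv_set relpow.simps)
qed simp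

lemma ball_steps_trace:
  "(x, y) \<in> ball_steps n ^^ k \<Longrightarrow> x \<in> carrier G \<Longrightarrow> wlen G S x \<le> n \<Longrightarrow>
    \<exists>w\<in>lists S. length w = k \<and> foldl (\<otimes>) x w = y \<and> edge_path_trace G x w \<subseteq> cayley_ball G S (real n)"
proof (induction k arbitrary: x)
  case 0
  then show ?case
    by (intro bexI[of _ "[]"]) (auto simp: cayley_ball_def Vertex_in_graph cayley_length_vertex)
next
  case (Suc k)
  then obtain z where z: "(x, z) \<in> ball_steps n" "(z, y) \<in> ball_steps n ^^ k"
    by (meson relpow_Suc_D2)
  then obtain a where a: "a \<in> S" "z = x \<otimes> a" "wlen G S z \<le> n" "wlen G S x + wlen G S z < 2 * n"
    by (auto simp: ball_steps_def)
  then have "z \<in> carrier G" using Suc.prems S_sub by auto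
  then obtain w where "w \<in> lists S" "length w = k" "foldl (\<otimes>) z w = y"
    "edge_path_trace G z w \<subseteq> cayley_ball G S (real n)"
    using Suc.IH[OF z(2)] a by blast
  then show ?case
    using a cayley_edge_in_ball[OF Suc.prems(2) a(1) Suc.prems(3), of] by (intro bexI[of _ "a # w"]) auto
qed

text \<open>Reduces almost convexity in the realization to word lengths and powers of
  \<open>ball_steps\<close>.\<close>

lemma almost_convexI:
  assumes "\<And>m. \<exists>K. \<forall>g\<in>carrier G. \<forall>g'\<in>carrier G. wlen G S g = wlen G S g' \<longrightarrow> wdist G S g g' \<le> m \<longrightarrow>
    (\<exists>k\<le>K. (g, g') \<in> ball_steps (wlen G S g) ^^ k)"
  shows "almost_convex G S"
  unfolding almost_convex_def almost_convex_at_def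
proof (intro allI)
  fix m
  obtain K where K: "\<And>g g'. g \<in> carrier G \<Longrightarrow> g' \<in> carrier G \<Longrightarrow> wlen G S g = wlen G S g' \<Longrightarrow>
      wdist G S g g' \<le> m \<Longrightarrow> \<exists>k\<le>K. (g, g') \<in> ball_steps (wlen G S g) ^^ k"
    using assms by meson
  show "\<exists>K::nat. \<forall>n::nat. \<forall>g\<in>carrier G. \<forall>g'\<in>carrier G.
        cayley_length G S (Vertex g) = real n \<and> cayley_length G S (Vertex g') = real n \<and>
        cayley_dist G S (Vertex g) (Vertex g') \<le> real m \<longrightarrow>
        (\<exists>w\<in>lists S. foldl (\<otimes>) g w = g' \<and>
           edge_path_trace G g w \<subseteq> cayley_ball G S (real n) \<and> length w \<le> K)"
  proof (intro exI[of _ K] allI ballI impI, elim conjE)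
    fix n g g' assume g: "g \<in> carrier G" "g' \<in> carrier G"
      and n: "cayley_length G S (Vertex g) = real n" "cayley_length G S (Vertex g') = real n"
      and d: "cayley_dist G S (Vertex g) (Vertex g') \<le> real m"
    have l: "wlen G S g = n" "wlen G S g' = n" "wdist G S g g' \<le> m"
      using g n d by (simp_all add: cayley_length_vertex cayley_dist_vertices)
    then obtain k where "k \<le> K" "(g, g') \<in> ball_steps n ^^ k" using K[OF g] by auto
    then show "\<exists>w\<in>lists S. foldl (\<otimes>) g w = g' \<and>
           edge_path_trace G g w \<subseteq> cayley_ball G S (real n) \<and> length w \<le> K"
      using ball_steps_trace[of g g' k n] g l by auto
  qed
qed

lemma finite_wlen_le:
  assumes "finite S" shows "finite {g \<in> carrier G. wlen G S g \<le> r}"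
proof (rule finite_subset)
  show "{g \<in> carrier G. wlen G S g \<le> r} \<subseteq> wprod G ` {w. set w \<subseteq> S \<and> length w \<le> r}"
  proof
    fix g assume g: "g \<in> {g \<in> carrier G. wlen G S g \<le> r}"
    then obtain w where "w \<in> lists S" "length w = wlen G S g" "wprod G w = g"
      using ex_geodesic_word by blast
    then show "g \<in> wprod G ` {w. set w \<subseteq> S \<and> length w \<le> r}"
      using g by (intro image_eqI[of _ _ w]) auto
  qed
qed (simp add: assms finite_lists_length_le)

end

section \<open>Central extensions of hyperbolic groups\<close>

lemma (in cayley) wdist_take:
  assumes "w \<in> lists S" "i \<le> j" "j \<le> length w"
  shows "wdist G S (wprod G (take i w)) (wprod G (take j w)) = wlen G S (wprod G (drop i (take j w)))"
proof -
  let ?u = "drop i (take j w)"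
  have u: "?u \<in> lists S" using assms take_lists drop_lists by simp
  have "take j w = take i w @ ?u" using assms by (metis append_take_drop_id min.absorb1 take_take)
  then have "wprod G (take j w) = wprod G (take i w) \<otimes> wprod G ?u"
    using wprod_append_lists[OF take_lists[OF assms(1), of i] u] by simp
  then show ?thesis
    using wdist_mult_right[OF wprod_lists[OF take_lists[OF assms(1), of i]] wprod_lists[OF u]] by simp
qed

text \<open>\<open>Y\<close> is a symmetric lift of a generating set of \<open>H\<close>, and
  \<open>Z\<^sub>A\<close> is a symmetric generating set of the central kernel. Hyperbolicity enters
  as discrete thinness of the word metric of \<open>H\<close>.\<close>

locale central_hyperbolic =
  G: group G + H: cayley H "\<pi> ` Y" + hyp: disc_hyperbolic "carrier H" "wdist H (\<pi> ` Y)" \<delta>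
  for G (structure) and H and \<pi> and Y and \<delta> +
  fixes Z\<^sub>A
  assumes hom: "\<pi> \<in> hom G H"
    and central: "k \<in> kernel G H \<pi> \<Longrightarrow> g \<in> carrier G \<Longrightarrow> k \<otimes> g = g \<otimes> k"
    and Y: "finite Y" "Y \<subseteq> carrier G" "a \<in> Y \<Longrightarrow> inv a \<in> Y"
    and Z\<^sub>A: "finite Z\<^sub>A" "Z\<^sub>A \<subseteq> kernel G H \<pi>" "a \<in> Z\<^sub>A \<Longrightarrow> inv a \<in> Z\<^sub>A"
      "generate G Z\<^sub>A = kernel G H \<pi>"
begin

section \<open>Projection to \<open>H\<close> and lifting of words\<close>

abbreviation ker where "ker \<equiv> kernel G H \<pi>"
abbreviation wp where "wp \<equiv> wprod G"
abbreviation iw where "iw w \<equiv> map (m_inv G) (rev w)"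

text \<open>The bound required by the stability results for local geodesics.\<close>

definition N where "N = 8 * \<delta> + 2"

definition hl where "hl g = wlen H (\<pi> ` Y) (\<pi> g)"

lemma hom_closed [simp]: "g \<in> carrier G \<Longrightarrow> \<pi> g \<in> carrier H"
  using hom_in_carrier[OF hom] .

lemma hom_mul: "g \<in> carrier G \<Longrightarrow> h \<in> carrier G \<Longrightarrow> \<pi> (g \<otimes> h) = \<pi> g \<otimes>\<^bsub>H\<^esub> \<pi> h"
  using Group.hom_mult[OF hom] .

lemma hom_1: "\<pi> \<one> = \<one>\<^bsub>H\<^esub>"
  using hom_one[OF hom G.is_group H.is_group] .

lemma hom_inv: "g \<in> carrier G \<Longrightarrow> \<pi> (inv g) = inv\<^bsub>H\<^esub> (\<pi> g)"
  using group_hom.hom_inv[of G H \<pi>] hom G.is_group H.is_group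
  by (simp add: group_hom_def group_hom_axioms_def)

lemma ker_iff: "k \<in> ker \<longleftrightarrow> k \<in> carrier G \<and> \<pi> k = \<one>\<^bsub>H\<^esub>"
  by (auto simp: kernel_def)

lemma ker_closed: "k \<in> ker \<Longrightarrow> k \<in> carrier G"
  by (simp add: ker_iff)

lemma ker_mult: "k \<in> ker \<Longrightarrow> k' \<in> ker \<Longrightarrow> k \<otimes> k' \<in> ker"
  by (simp add: ker_iff hom_mul)

lemma ker_quotient:
  assumes "g \<in> carrier G" "h \<in> carrier G" "\<pi> g = \<pi> h" shows "inv g \<otimes> h \<in> ker"
  using assms by (simp add: ker_iff hom_mul hom_inv)

lemma wprod_ker: "set w \<subseteq> ker \<Longrightarrow> wp w \<in> ker"
  by (induction w) (auto intro: ker_mult simp: ker_iff[of \<one>] hom_1)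

lemma listsY: "w \<in> lists Y \<Longrightarrow> set w \<subseteq> carrier G"
  using Y(2) by auto

lemma wpY [simp]: "w \<in> lists Y \<Longrightarrow> wp w \<in> carrier G"
  using listsY G.wprod_closed by blast

lemma wp_append: "u \<in> lists Y \<Longrightarrow> v \<in> lists Y \<Longrightarrow> wp (u @ v) = wp u \<otimes> wp v"
  using listsY G.wprod_append by blast

lemma iw_lists: "w \<in> lists Y \<Longrightarrow> iw w \<in> lists Y"
  using Y(3) by auto

lemma wp_iw: "w \<in> lists Y \<Longrightarrow> wp (iw w) = inv (wp w)"
  using listsY G.wprod_inv by blast

lemma hom_wp: "w \<in> lists Y \<Longrightarrow> \<pi> (wp w) = wprod H (map \<pi> w)"
  using G.hom_wprod[OF H.is_group hom listsY] .

lemma map_lists: "w \<in> lists Y \<Longrightarrow> map \<pi> w \<in> lists (\<pi> ` Y)"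
  by auto

lemma lift_word:
  assumes "g \<in> carrier G"
  obtains v where "v \<in> lists Y" "length v = hl g" "\<pi> (wp v) = \<pi> g"
proof -
  obtain w where w: "w \<in> lists (\<pi> ` Y)" "length w = hl g" "wprod H w = \<pi> g"
    using H.ex_geodesic_word[OF hom_closed[OF assms]] unfolding hl_def .
  then obtain v where "v \<in> lists Y" "w = map \<pi> v" by (auto simp: lists_image)
  then show ?thesis using that w hom_wp by auto
qed

lemma hl_word: "w \<in> lists Y \<Longrightarrow> hl (wp w) \<le> length w"
  using H.wlen_le[OF map_lists, of w] by (simp add: hl_def hom_wp)

lemma hl_mult: "g \<in> carrier G \<Longrightarrow> h \<in> carrier G \<Longrightarrow> hl (g \<otimes> h) \<le> hl g + hl h"
  by (simp add: hl_def hom_mul H.wlen_mult)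

lemma hl_mult_ker: "g \<in> carrier G \<Longrightarrow> k \<in> ker \<Longrightarrow> hl (g \<otimes> k) = hl g"
  by (simp add: hl_def hom_mul ker_iff)

section \<open>The central generators\<close>

definition Z\<^sub>0 where
  "Z\<^sub>0 = {inv (wp u) \<otimes> wp v |u v. u \<in> lists Y \<and> v \<in> lists Y \<and> length u \<le> N \<and> length v \<le> N \<and>
     \<pi> (wp u) = \<pi> (wp v)}"

definition Z\<^sub>1 where "Z\<^sub>1 = Z\<^sub>0 \<union> Z\<^sub>A"

text \<open>Packing four factors into one letter lowers the isoperimetric constant from 1 to 1/4,
  and the later length comparisons need it to be well below 1.\<close>

definition Z where "Z = wp ` {zs \<in> lists Z\<^sub>1. length zs \<le> 4}"

lemma Z\<^sub>0_ker: "Z\<^sub>0 \<subseteq> ker"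
proof
  fix b assume "b \<in> Z\<^sub>0"
  then obtain u v where "b = inv (wp u) \<otimes> wp v" "u \<in> lists Y" "v \<in> lists Y" "\<pi> (wp u) = \<pi> (wp v)"
    unfolding Z\<^sub>0_def by blast
  then show "b \<in> ker" using ker_quotient[OF wpY wpY] by simp
qed

lemma Z\<^sub>0_inv: assumes "b \<in> Z\<^sub>0" shows "inv b \<in> Z\<^sub>0"
proof -
  obtain u v where uv: "b = inv (wp u) \<otimes> wp v" "u \<in> lists Y" "v \<in> lists Y" "length u \<le> N" "length v \<le> N"
    "\<pi> (wp u) = \<pi> (wp v)" using assms unfolding Z\<^sub>0_def by blast
  then have "inv b = inv (wp v) \<otimes> wp u" by (simp add: G.inv_mult_group del: in_lists_conv_set)
  then show ?thesis
    unfolding Z\<^sub>0_def mem_Collect_eq using uv(2-6) by (intro exI[of _ v] exI[of _ u]) simp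
qed

lemma Z\<^sub>0_finite: "finite Z\<^sub>0"
proof (rule finite_subset)
  let ?W = "{w. set w \<subseteq> Y \<and> length w \<le> N}"
  show "Z\<^sub>0 \<subseteq> (\<lambda>(u, v). inv (wp u) \<otimes> wp v) ` (?W \<times> ?W)" by (auto simp: Z\<^sub>0_def)
  show "finite ((\<lambda>(u, v). inv (wp u) \<otimes> wp v) ` (?W \<times> ?W))"
    using finite_lists_length_le[OF Y(1)] by auto
qed

lemma Z\<^sub>1_ker: "Z\<^sub>1 \<subseteq> ker"
  using Z\<^sub>0_ker Z\<^sub>A by (simp add: Z\<^sub>1_def)

lemma Z_ker: "Z \<subseteq> ker"
  using Z\<^sub>1_ker wprod_ker by (auto simp: Z_def)

lemma Z_carrier: "Z \<subseteq> carrier G"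
  using Z_ker ker_closed by blast

lemma Z_finite: "finite Z"
proof -
  have "{zs \<in> lists Z\<^sub>1. length zs \<le> 4} = {zs. set zs \<subseteq> Z\<^sub>1 \<and> length zs \<le> 4}" by auto
  then show ?thesis
    unfolding Z_def using finite_lists_length_le[of Z\<^sub>1 4] Z\<^sub>0_finite Z\<^sub>A by (simp add: Z\<^sub>1_def)
qed

lemma Z_inv: assumes "z \<in> Z" shows "inv z \<in> Z"
proof -
  obtain zs where zs: "zs \<in> lists Z\<^sub>1" "length zs \<le> 4" "z = wp zs" using assms by (auto simp: Z_def)
  have "set zs \<subseteq> carrier G" using zs(1) Z\<^sub>1_ker ker_closed by auto
  then have "inv z = wp (iw zs)" using G.wprod_inv zs by simp
  moreover have "inv b \<in> Z\<^sub>1" if "b \<in> Z\<^sub>1" for b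
    using that Z\<^sub>0_inv Z\<^sub>A(3) by (auto simp: Z\<^sub>1_def)
  then have "iw zs \<in> lists Z\<^sub>1" using zs(1) by auto
  ultimately show ?thesis unfolding Z_def using zs by (intro image_eqI[of _ _ "iw zs"]) auto
qed

lemma Z\<^sub>A_Z: "Z\<^sub>A \<subseteq> Z"
proof
  fix a assume a: "a \<in> Z\<^sub>A"
  then have "a \<in> carrier G" using Z\<^sub>A ker_closed by blast
  then show "a \<in> Z" unfolding Z_def using a by (intro image_eqI[of _ _ "[a]"]) (auto simp: Z\<^sub>1_def)
qed

lemma wpZ_ker [simp]: "zs \<in> lists Z \<Longrightarrow> wp zs \<in> ker"
  using wprod_ker Z_ker by (metis lists_mono in_lists_conv_set subset_iff)

lemma wpZ [simp]: "zs \<in> lists Z \<Longrightarrow> wp zs \<in> carrier G"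
  using wpZ_ker ker_closed by blast

lemma wpZ_append: "u \<in> lists Z \<Longrightarrow> v \<in> lists Z \<Longrightarrow> wp (u @ v) = wp u \<otimes> wp v"
  using G.wprod_append Z_carrier by (metis lists_mono in_lists_conv_set subset_iff)

text \<open>The word is cut into blocks of four letters; the summand 3 rounds up for the last
  block.\<close>

lemma group_into_Z:
  assumes "zs \<in> lists Z\<^sub>1"
  shows "\<exists>ys\<in>lists Z. 4 * length ys \<le> length zs + 3 \<and> wp ys = wp zs"
  using assms
proof (induction "length zs" arbitrary: zs rule: less_induct)
  case less
  show ?case
  proof (cases "zs = []")
    case True
    then show ?thesis by (intro bexI[of _ "[]"]) auto
  next
    case False
    have C: "set zs \<subseteq> carrier G" using less.prems Z\<^sub>1_ker ker_closed by auto
    have l: "take 4 zs \<in> lists Z\<^sub>1" "drop 4 zs \<in> lists Z\<^sub>1"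
      using less.prems by (auto dest: in_set_takeD in_set_dropD)
    have "length (drop 4 zs) < length zs" using False by simp
    from less.hyps[OF this l(2)] obtain ys where ys: "ys \<in> lists Z" "4 * length ys \<le> length (drop 4 zs) + 3"
      "wp ys = wp (drop 4 zs)" by blast
    have z: "wp (take 4 zs) \<in> Z" unfolding Z_def using l(1) by (intro image_eqI[of _ _ "take 4 zs"]) auto
    have "set (take 4 zs) \<subseteq> carrier G" "set (drop 4 zs) \<subseteq> carrier G"
      using C by (meson order_trans set_take_subset set_drop_subset)+
    from G.wprod_append[OF this] have eq: "wp zs = wp (wp (take 4 zs) # ys)" using ys(3) by simp
    show ?thesis
    proof (cases "length zs \<le> 4")
      case True
      then show ?thesis using z G.r_one Z_carrier False
        by (intro bexI[of _ "[wp (take 4 zs)]"]) (auto simp: Suc_leI)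
    next
      case False
      then show ?thesis using ys z eq by (intro bexI[of _ "wp (take 4 zs) # ys"]) auto
    qed
  qed
qed

section \<open>Dehn's algorithm and the linear isoperimetric inequality\<close>

definition local_word where
  "local_word w \<longleftrightarrow> w \<in> lists Y \<and> (\<forall>u v x. w = u @ v @ x \<longrightarrow> length v \<le> N \<longrightarrow> hl (wp v) = length v)"

text \<open>One step of Dehn's algorithm: a short subword with non-geodesic image is replaced by the
  lift of a geodesic. The discrepancy lies in \<open>Z\<^sub>0\<close> and is central, so it can be
  moved to the end.\<close>

lemma not_local_word:
  assumes w: "w \<in> lists Y" "\<not> local_word w"
  obtains w' b where "w' \<in> lists Y" "length w' < length w" "b \<in> Z\<^sub>0" "wp w = wp w' \<otimes> b"
proof -
  obtain u v x where uvx: "w = u @ v @ x" "length v \<le> N" "hl (wp v) \<noteq> length v"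
    using w unfolding local_word_def by blast
  then have L: "u \<in> lists Y" "v \<in> lists Y" "x \<in> lists Y" using w by auto
  then have less: "hl (wp v) < length v" using uvx hl_word[of v] by simp
  obtain v' where v': "v' \<in> lists Y" "length v' = hl (wp v)" "\<pi> (wp v') = \<pi> (wp v)"
    using lift_word[OF wpY[OF L(2)]] .
  define b where "b = inv (wp v') \<otimes> wp v"
  have b: "b \<in> Z\<^sub>0" unfolding Z\<^sub>0_def b_def using v' L less uvx(2) by fastforce
  then have bk: "b \<in> ker" "b \<in> carrier G" using Z\<^sub>0_ker ker_closed by auto
  have C: "wp u \<in> carrier G" "wp v \<in> carrier G" "wp x \<in> carrier G" "wp v' \<in> carrier G"
    using L v'(1) wpY by blast+
  have vb: "wp v = wp v' \<otimes> b" unfolding b_def using C by (simp flip: G.m_assoc)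
  have 1: "wp w = wp u \<otimes> (wp v \<otimes> wp x)"
    unfolding uvx(1) using L wp_append[of u "v @ x"] wp_append[of v x] by simp
  have "wp w = wp u \<otimes> (wp v' \<otimes> (b \<otimes> wp x))" unfolding 1 vb using C bk by (simp add: G.m_assoc)
  also have "\<dots> = wp u \<otimes> (wp v' \<otimes> (wp x \<otimes> b))" using central[OF bk(1) C(3)] by simp
  also have "\<dots> = wp u \<otimes> (wp v' \<otimes> wp x) \<otimes> b" using C bk by (simp add: G.m_assoc)
  also have "wp u \<otimes> (wp v' \<otimes> wp x) = wp (u @ v' @ x)"
    using L v'(1) wp_append[of u "v' @ x"] wp_append[of v' x] by simp
  finally have "wp w = wp (u @ v' @ x) \<otimes> b" .
  moreover have "u @ v' @ x \<in> lists Y" using L v'(1) by simp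
  moreover have "length (u @ v' @ x) < length w" using uvx v' less by simp
  ultimately show ?thesis using that b by blast
qed

definition track where "track w i = \<pi> (wp (take i w))"

lemma takeY: "w \<in> lists Y \<Longrightarrow> take i w \<in> lists Y"
  and dropY: "w \<in> lists Y \<Longrightarrow> drop i w \<in> lists Y"
  by (auto dest: in_set_takeD in_set_dropD)

lemma track_dist:
  assumes "w \<in> lists Y" "i \<le> j" "j \<le> length w"
  shows "wdist H (\<pi> ` Y) (track w i) (track w j) = hl (wp (drop i (take j w)))"
proof -
  have "track w k = wprod H (take k (map \<pi> w))" for k
    using hom_wp[OF takeY[OF assms(1), of k]] by (simp add: track_def take_map)
  moreover have "\<pi> (wp (drop i (take j w))) = wprod H (drop i (take j (map \<pi> w)))"
    using hom_wp[OF dropY[OF takeY[OF assms(1), of j], of i]] by (simp add: take_map drop_map)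
  ultimately show ?thesis
    using H.wdist_take[OF map_lists[OF assms(1)] assms(2)] assms(3) by (simp add: hl_def)
qed

lemma local_word_track:
  assumes "local_word w"
  shows "local_geod (carrier H) (wdist H (\<pi> ` Y)) N (length w) (track w)"
  unfolding local_geod_def
proof (intro conjI allI impI)
  have w: "w \<in> lists Y" using assms by (simp add: local_word_def)
  show "track w i \<in> carrier H" for i using takeY[OF w] by (simp add: track_def)
  fix i j assume ij: "i \<le> j" "j \<le> length w" "j - i \<le> N"
  have "take j w = take i w @ drop i (take j w)" using ij by (metis append_take_drop_id min.absorb1 take_take)
  then have "w = take i w @ drop i (take j w) @ drop j w" by (metis append.assoc append_take_drop_id)
  moreover have "length (drop i (take j w)) = j - i" using ij by simp
  ultimately have "hl (wp (drop i (take j w))) = j - i"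
    using assms ij unfolding local_word_def by metis
  then show "wdist H (\<pi> ` Y) (track w i) (track w j) = j - i" using track_dist[OF w ij(1,2)] by simp
qed

lemma local_word_trivial:
  assumes "local_word w" "\<pi> (wp w) = \<one>\<^bsub>H\<^esub>" shows "w = []"
proof -
  have "track w (length w) = track w 0" using assms(2) by (simp add: track_def hom_1)
  from hyp.local_geod_loop[OF local_word_track[OF assms(1)] _ this] show ?thesis by (simp add: N_def)
qed

text \<open>Each Dehn step costs one letter of \<open>Z\<^sub>0\<close> and removes at least one
  letter of \<open>w\<close>. It can only stop at a local word, and by
  \<open>local_word_trivial\<close> such a word with trivial image is empty.\<close>

lemma linear_isoperimetric:
  assumes "w \<in> lists Y" "\<pi> (wp w) = \<one>\<^bsub>H\<^esub>"
  shows "\<exists>zs\<in>lists Z\<^sub>0. length zs \<le> length w \<and> wp zs = wp w"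
  using assms
proof (induction "length w" arbitrary: w rule: less_induct)
  case less
  show ?case
  proof (cases "local_word w")
    case True
    then have "w = []" using local_word_trivial less.prems by blast
    then show ?thesis by (intro bexI[of _ "[]"]) auto
  next
    case False
    obtain w' b where w': "w' \<in> lists Y" "length w' < length w" "b \<in> Z\<^sub>0" "wp w = wp w' \<otimes> b"
      using not_local_word[OF less.prems(1) False] .
    have b: "b \<in> ker" "b \<in> carrier G" using w'(3) Z\<^sub>0_ker ker_closed by auto
    have "\<pi> (wp w') = \<one>\<^bsub>H\<^esub>" using less.prems(2) w'(1,4) b by (simp add: hom_mul ker_iff)
    from less.hyps[OF w'(2,1) this] obtain zs where zs: "zs \<in> lists Z\<^sub>0" "length zs \<le> length w'" "wp zs = wp w'"
      by blast
    have "wp (b # zs) = wp w" using zs(3) w'(4) central[OF b(1) wpY[OF w'(1)]] by simp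
    then show ?thesis using zs w' by (intro bexI[of _ "b # zs"]) auto
  qed
qed

lemma filling:
  assumes "w \<in> lists Y" "\<pi> (wp w) = \<one>\<^bsub>H\<^esub>"
  shows "\<exists>zs\<in>lists Z. 4 * length zs \<le> length w + 3 \<and> wp zs = wp w"
proof -
  obtain zs where zs: "zs \<in> lists Z\<^sub>0" "length zs \<le> length w" "wp zs = wp w"
    using linear_isoperimetric[OF assms] by blast
  then have "zs \<in> lists Z\<^sub>1" by (auto simp: Z\<^sub>1_def)
  from group_into_Z[OF this] obtain ys where "ys \<in> lists Z" "4 * length ys \<le> length zs + 3" "wp ys = wp zs"
    by blast
  then show ?thesis using zs(2,3) by (intro bexI[of _ ys]) auto
qed

section \<open>The generating set of \<open>G\<close> and its normal forms\<close>

definition gens where "gens = Y \<union> Z"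

lemma gens_generating_set: "generating_set G gens"
proof -
  have sub: "gens \<subseteq> carrier G" using Y Z_carrier by (simp add: gens_def)
  have inv: "inv a \<in> gens" if "a \<in> gens" for a using that Y Z_inv by (auto simp: gens_def)
  have "carrier G \<subseteq> generate G gens"
  proof
    fix g assume g: "g \<in> carrier G"
    obtain v where v: "v \<in> lists Y" "\<pi> (wp v) = \<pi> g" using lift_word[OF g] .
    have "inv (wp v) \<otimes> g \<in> generate G Z\<^sub>A"
      using ker_quotient[OF wpY[OF v(1)] g v(2)] Z\<^sub>A(4) by simp
    moreover have "Z\<^sub>A \<subseteq> carrier G" using Z\<^sub>A(2) ker_closed by blast
    ultimately obtain w where w: "w \<in> lists Z\<^sub>A" "inv (wp v) \<otimes> g = wp w"
      using G.generate_wprod[OF _ Z\<^sub>A(3)] by auto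
    have "set v \<subseteq> carrier G" "set w \<subseteq> carrier G" using v(1) w(1) Y(2) \<open>Z\<^sub>A \<subseteq> carrier G\<close> by auto
    from G.wprod_append[OF this] have "wp (v @ w) = wp v \<otimes> (inv (wp v) \<otimes> g)" using w by simp
    then have "g = wp (v @ w)" using g wpY[OF v(1)] by (simp flip: G.m_assoc)
    moreover have "v @ w \<in> lists gens" using v(1) w(1) Z\<^sub>A_Z by (auto simp: gens_def)
    ultimately show "g \<in> generate G gens" using G.generate_wprod[OF sub inv] by blast
  qed
  moreover have "generate G gens \<subseteq> carrier G" using G.generate_in_carrier[OF sub] by blast
  ultimately show ?thesis
    using sub inv Y(1) Z_finite by (auto simp: generating_set_def gens_def)
qed

sublocale S: cayley G gens
  using gens_generating_set by unfold_locales (auto simp: generating_set_def)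

lemma gens_finite: "finite gens"
  using gens_generating_set by (simp add: generating_set_def)

abbreviation len where "len \<equiv> wlen G gens"

lemma lists_gens: "w \<in> lists Y \<Longrightarrow> w \<in> lists gens" "zs \<in> lists Z \<Longrightarrow> zs \<in> lists gens"
  by (auto simp: gens_def)

lemma Z\<^sub>0_Z: "Z\<^sub>0 \<subseteq> Z"
proof
  fix b assume b: "b \<in> Z\<^sub>0"
  then have "b \<in> carrier G" using Z\<^sub>0_ker ker_closed by blast
  then show "b \<in> Z" unfolding Z_def using b by (intro image_eqI[of _ _ "[b]"]) (auto simp: Z\<^sub>1_def)
qed

lemma len_nf: "w \<in> lists Y \<Longrightarrow> zs \<in> lists Z \<Longrightarrow> len (wp w \<otimes> wp zs) \<le> length w + length zs"
  using S.wlen_le[of "w @ zs"] S.wprod_append_lists[of w zs] lists_gens by simp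

text \<open>Letters of \<open>Z\<close> are central, so they can be collected at the end without
  changing the length.\<close>

lemma sorted_word:
  "s \<in> lists gens \<Longrightarrow> \<exists>w\<in>lists Y. \<exists>zs\<in>lists Z. length w + length zs = length s \<and> wp s = wp w \<otimes> wp zs"
proof (induction s)
  case Nil
  show ?case by (intro bexI[of _ "[]"]) auto
next
  case (Cons a s)
  then obtain w zs where wz: "w \<in> lists Y" "zs \<in> lists Z" "length w + length zs = length s"
    "wp s = wp w \<otimes> wp zs" by auto
  have C: "a \<in> carrier G" "wp w \<in> carrier G" "wp zs \<in> carrier G"
    using Cons.prems S.S_sub wpY[OF wz(1)] wpZ[OF wz(2)] by auto
  show ?case
  proof (cases "a \<in> Y")
    case True
    then show ?thesis using wz C
      by (intro bexI[of _ "a # w"] bexI[of _ zs]) (auto simp: G.m_assoc)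
  next
    case False
    then have a: "a \<in> Z" using Cons.prems by (auto simp: gens_def)
    then have "a \<otimes> wp w = wp w \<otimes> a" using central Z_ker C by blast
    then have "a \<otimes> (wp w \<otimes> wp zs) = wp w \<otimes> (a \<otimes> wp zs)" using C by (simp flip: G.m_assoc)
    then show ?thesis using wz a
      by (intro bexI[of _ w] bexI[of _ "a # zs"]) auto
  qed
qed

lemma ex_sorted:
  assumes "g \<in> carrier G"
  obtains w zs where "w \<in> lists Y" "zs \<in> lists Z" "length w + length zs = len g" "g = wp w \<otimes> wp zs"
proof -
  obtain s where s: "s \<in> lists gens" "length s = len g" "wp s = g" using S.ex_geodesic_word[OF assms] .
  from sorted_word[OF s(1)] obtain w zs where "w \<in> lists Y" "zs \<in> lists Z"
    "length w + length zs = length s" "wp s = wp w \<otimes> wp zs" by blast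
  then show ?thesis using that s(2,3) by simp
qed

text \<open>Among the geodesic words \<open>w zs\<close> for \<open>g\<close>, one with \<open>w\<close> shortest is locally geodesic in \<open>H\<close>, since
  a shortening of \<open>w\<close> costs at most one letter of \<open>Z\<close>.\<close>

lemma geodesic_form:
  assumes "g \<in> carrier G"
  obtains w zs where "local_word w" "w \<in> lists Y" "zs \<in> lists Z" "length w + length zs = len g" "g = wp w \<otimes> wp zs"
proof -
  define P where "P p \<longleftrightarrow> fst p \<in> lists Y \<and> snd p \<in> lists Z \<and> length (fst p) + length (snd p) = len g \<and>
      g = wp (fst p) \<otimes> wp (snd p)" for p
  obtain w0 zs0 where "P (w0, zs0)" using ex_sorted[OF assms] unfolding P_def by (metis fst_conv snd_conv)
  from ex_has_least_nat[of P, OF this, of "\<lambda>p. length (fst p)"]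
  obtain p where p: "P p" "\<And>q. P q \<Longrightarrow> length (fst p) \<le> length (fst q)" by blast
  obtain w zs where wz: "p = (w, zs)" by (cases p)
  have w: "w \<in> lists Y" "zs \<in> lists Z" "length w + length zs = len g" "g = wp w \<otimes> wp zs"
    using p(1) by (simp_all add: wz P_def)
  have "local_word w"
  proof (rule ccontr)
    assume "\<not> local_word w"
    then obtain w' b where w': "w' \<in> lists Y" "length w' < length w" "b \<in> Z\<^sub>0" "wp w = wp w' \<otimes> b"
      using not_local_word[OF w(1)] by blast
    have b: "b \<in> Z" "b \<in> carrier G" using w'(3) Z\<^sub>0_Z Z_carrier by auto
    have z: "b # zs \<in> lists Z" using b w by simp
    have g: "g = wp w' \<otimes> wp (b # zs)"
      using w(4) w'(4) b wpY[OF w'(1)] wpZ[OF w(2)] by (simp add: G.m_assoc)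
    \<comment> \<open>The word \<open>w'\<close> is shorter than \<open>w\<close> by at least 1,
      which makes room for the letter \<open>b\<close>; hence the new word is again
      geodesic.\<close>
    have "len g \<le> length w' + length (b # zs)" unfolding g using len_nf[OF w'(1) z] .
    then have "P (w', b # zs)" unfolding P_def using w' w z g by simp
    from p(2)[OF this] w'(2) show False by (simp add: wz)
  qed
  then show ?thesis using that w by blast
qed

section \<open>Pieces of geodesic normal forms\<close>

lemma nf_split:
  assumes "w1 \<in> lists Y" "w2 \<in> lists Y" "zs \<in> lists Z"
  shows "wp (w1 @ w2) \<otimes> wp zs = (wp w1 \<otimes> wp zs) \<otimes> wp w2"
proof -
  have C: "wp w1 \<in> carrier G" "wp w2 \<in> carrier G" "wp zs \<in> carrier G"
    using wpY[OF assms(1)] wpY[OF assms(2)] wpZ[OF assms(3)] .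
  show ?thesis
    unfolding wp_append[OF assms(1,2)] using C central[OF wpZ_ker[OF assms(3)] C(2)]
    by (simp add: G.m_assoc)
qed

text \<open>Since the \<open>Z\<close>-letters may be written between \<open>w1\<close> and
  \<open>w2\<close>, both \<open>w1 zs\<close> and \<open>w2\<close> are subwords of a geodesic
  word.\<close>

lemma geodesic_split:
  assumes w: "w1 \<in> lists Y" "w2 \<in> lists Y" "zs \<in> lists Z"
    and geo: "len (wp (w1 @ w2) \<otimes> wp zs) = length (w1 @ w2) + length zs"
  shows "len (wp w1 \<otimes> wp zs) = length w1 + length zs" "len (wp w2) = length w2"
proof -
  have C: "wp w1 \<otimes> wp zs \<in> carrier G" "wp w2 \<in> carrier G"
    using wpY[OF w(1)] wpY[OF w(2)] wpZ[OF w(3)] by auto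
  have "length w1 + length w2 + length zs \<le> len (wp w1 \<otimes> wp zs) + len (wp w2)"
    using geo S.wlen_mult[OF C] unfolding nf_split[OF w] by simp
  moreover have "len (wp w1 \<otimes> wp zs) \<le> length w1 + length zs" using len_nf[OF w(1,3)] .
  moreover have "len (wp w2) \<le> length w2" using S.wlen_le[OF lists_gens(1)[OF w(2)]] .
  ultimately show "len (wp w1 \<otimes> wp zs) = length w1 + length zs" "len (wp w2) = length w2" by linarith+
qed

text \<open>Let \<open>u\<close> lift a geodesic of \<open>H\<close> with the same end as the image
  of \<open>v\<close>. Filling the loop made of \<open>u\<close> and \<open>v\<close> costs at most
  a quarter of its length, up to rounding, so \<open>4 * length v\<close> is at most
  \<open>5 * length u + length v + 3\<close>.\<close>

lemma quasi_geodesic: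
  assumes v: "v \<in> lists Y" "len (wp v) = length v"
  shows "3 * length v \<le> 5 * hl (wp v) + 3"
proof -
  obtain u where u: "u \<in> lists Y" "length u = hl (wp v)" "\<pi> (wp u) = \<pi> (wp v)"
    using lift_word[OF wpY[OF v(1)]] .
  have C: "wp u \<in> carrier G" "wp v \<in> carrier G" using wpY[OF u(1)] wpY[OF v(1)] .
  have loop: "iw u @ v \<in> lists Y" using iw_lists[OF u(1)] v by simp
  have eq: "wp (iw u @ v) = inv (wp u) \<otimes> wp v"
    using wp_append[OF iw_lists[OF u(1)] v(1)] wp_iw[OF u(1)] by simp
  have "\<pi> (wp (iw u @ v)) = \<one>\<^bsub>H\<^esub>"
    using ker_quotient[OF C u(3)] unfolding eq ker_iff by simp
  from filling[OF loop this] obtain zs where zs: "zs \<in> lists Z" "4 * length zs \<le> length u + length v + 3"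
    "wp zs = inv (wp u) \<otimes> wp v" unfolding eq by auto
  have "wp v = wp u \<otimes> wp zs" unfolding zs(3) using C by (simp flip: G.m_assoc)
  then have "length v \<le> length u + length zs" using len_nf[OF u(1) zs(1)] v(2) by simp
  then show ?thesis using zs(2) u(2) by linarith
qed

section \<open>Joining nearby points of a sphere\<close>

lemma hl_le_len: assumes "g \<in> carrier G" shows "hl g \<le> len g"
proof -
  obtain w zs where w: "w \<in> lists Y" "zs \<in> lists Z" "length w + length zs = len g" "g = wp w \<otimes> wp zs"
    using ex_sorted[OF assms] .
  have "hl g = hl (wp w)" unfolding w(4) using hl_mult_ker[OF wpY[OF w(1)] wpZ_ker[OF w(2)]] .
  then show ?thesis using hl_word[OF w(1)] w(3) by linarith
qed

text \<open>When both \<open>Y\<close>-words are bounded, the two \<open>Z\<close>-words differ by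
  an element of a finite set. Common descent then yields a central element from which both points
  are reached by ascending words of bounded length.\<close>

lemma short_projections:
  "\<exists>B. \<forall>w\<in>lists Y. \<forall>w'\<in>lists Y. \<forall>zs\<in>lists Z. \<forall>zs'\<in>lists Z. \<forall>q\<in>carrier G. \<forall>n.
     length w \<le> R \<longrightarrow> length w' \<le> R \<longrightarrow> len q \<le> R \<longrightarrow>
     wp w' \<otimes> wp zs' = wp w \<otimes> wp zs \<otimes> q \<longrightarrow> length w + length zs = n \<longrightarrow> length w' + length zs' = n \<longrightarrow>
     (\<exists>k\<le>B. (wp w \<otimes> wp zs, wp w' \<otimes> wp zs') \<in> S.ball_steps n ^^ k)"
proof -
  \<comment> \<open>It contains every \<open>e\<close> below, a product of three elements of length
    at most \<open>R\<close>. Finiteness permits one bound \<open>B\<close> for all of them.\<close>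
  define Q where "Q = {g \<in> carrier G. len g \<le> 3 * R}"
  have finQ: "finite Q" unfolding Q_def by (rule S.finite_wlen_le[OF gens_finite])
  define good where "good e B \<longleftrightarrow> (\<forall>zs\<in>lists Z. \<forall>zs'\<in>lists Z. e \<otimes> wp zs = wp zs' \<longrightarrow>
    (\<exists>ms\<in>lists Z. \<exists>ms'\<in>lists Z. \<exists>ks\<in>lists Z. \<exists>ks'\<in>lists Z.
      length ms \<le> B \<and> length ms' \<le> B \<and>
      length zs = length ms + length ks \<and> length zs' = length ms' + length ks' \<and>
      wp zs = wp ms \<otimes> wp ks \<and> wp zs' = wp ms' \<otimes> wp ks' \<and> wp ks = wp ks'))" for e B
  have Zcomm: "x \<otimes> y = y \<otimes> x" if "x \<in> Z" "y \<in> Z" for x y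
    using that central Z_ker Z_carrier by blast
  have "\<forall>e\<in>Q. \<exists>B. good e B"
    unfolding good_def using G.common_descent[OF Z_finite Z_carrier Zcomm] by (auto simp: Q_def)
  then obtain f where f: "\<And>e. e \<in> Q \<Longrightarrow> good e (f e)" by metis
  define B where "B = Max (f ` Q)"
  have fB: "f e \<le> B" if "e \<in> Q" for e unfolding B_def using finQ that by (intro Max_ge) auto
  show ?thesis
  proof (rule exI[of _ "(R + B) + (R + B)"], intro ballI allI impI)
    fix w w' zs zs' q n
    assume w: "w \<in> lists Y" "w' \<in> lists Y" "zs \<in> lists Z" "zs' \<in> lists Z" and q: "q \<in> carrier G"
      and R: "length w \<le> R" "length w' \<le> R" "len q \<le> R"
      and eq: "wp w' \<otimes> wp zs' = wp w \<otimes> wp zs \<otimes> q"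
      and n: "length w + length zs = n" "length w' + length zs' = n"
    have C: "wp w \<in> carrier G" "wp w' \<in> carrier G" "wp zs \<in> carrier G" "wp zs' \<in> carrier G"
      using wpY[OF w(1)] wpY[OF w(2)] wpZ[OF w(3)] wpZ[OF w(4)] .
    define e where "e = inv (wp w') \<otimes> (wp w \<otimes> q)"
    have eC: "e \<in> carrier G" using C q by (simp add: e_def)
    have "len e \<le> len (inv (wp w')) + (len (wp w) + len q)"
      unfolding e_def using S.wlen_mult[of "inv (wp w')" "wp w \<otimes> q"] S.wlen_mult[OF C(1) q] C q by simp
    also have "\<dots> \<le> R + (R + R)"
      using S.wlen_inv[OF C(2)] S.wlen_le[OF lists_gens(1)[OF w(1)]] S.wlen_le[OF lists_gens(1)[OF w(2)]] R by simp
    finally have eQ: "e \<in> Q" using eC by (simp add: Q_def)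
    have "wp zs' = inv (wp w') \<otimes> (wp w' \<otimes> wp zs')" using C by (simp flip: G.m_assoc)
    also have "\<dots> = inv (wp w') \<otimes> (wp w \<otimes> (wp zs \<otimes> q))" unfolding eq using C q by (simp add: G.m_assoc)
    also have "\<dots> = e \<otimes> wp zs"
      unfolding e_def central[OF wpZ_ker[OF w(3)] q] using C q by (simp add: G.m_assoc)
    finally have "e \<otimes> wp zs = wp zs'" by simp
    then obtain ms ms' ks ks' where L: "ms \<in> lists Z" "ms' \<in> lists Z" "ks \<in> lists Z" "ks' \<in> lists Z"
      and l: "length ms \<le> f e" "length ms' \<le> f e" "length zs = length ms + length ks"
        "length zs' = length ms' + length ks'"
      and p: "wp zs = wp ms \<otimes> wp ks" "wp zs' = wp ms' \<otimes> wp ks'" "wp ks = wp ks'"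
      using f[OF eQ, unfolded good_def] w(3,4) by meson
    have MC: "wp ms \<in> carrier G" "wp ms' \<in> carrier G" "wp ks \<in> carrier G"
      using wpZ[OF L(1)] wpZ[OF L(2)] wpZ[OF L(3)] .
    have up: "(wp ks, wp u \<otimes> (wp us \<otimes> wp ks)) \<in> S.ball_steps n ^^ (length u + length us)"
      if u: "u \<in> lists Y" "us \<in> lists Z" and le: "len (wp ks) + (length u + length us) \<le> n" for u us
    proof -
      have UC: "wp u \<in> carrier G" "wp us \<in> carrier G" using wpY[OF u(1)] wpZ[OF u(2)] .
      have "u @ us \<in> lists gens" using lists_gens(1)[OF u(1)] lists_gens(2)[OF u(2)] by simp
      from S.ball_steps_up[OF this MC(3)]
      have "(wp ks, wp ks \<otimes> wp (u @ us)) \<in> S.ball_steps n ^^ (length u + length us)" using le by simp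
      moreover have "wp (u @ us) = wp u \<otimes> wp us"
        using S.wprod_append_lists[OF lists_gens(1)[OF u(1)] lists_gens(2)[OF u(2)]] .
      moreover have "wp ks \<otimes> (wp u \<otimes> wp us) = wp u \<otimes> (wp us \<otimes> wp ks)"
        using central[OF wpZ_ker[OF L(3)], of "wp u \<otimes> wp us"] UC MC by (simp add: G.m_assoc)
      ultimately show ?thesis by simp
    qed
    \<comment> \<open>The words \<open>ks\<close> and \<open>ks'\<close> may differ, but each bounds
      the length of their common product. So each ascent has total length at most
      \<open>n\<close>.\<close>
    have "len (wp ks) \<le> length ks" using S.wlen_le[OF lists_gens(2)[OF L(3)]] .
    then have 1: "(wp ks, wp w \<otimes> wp zs) \<in> S.ball_steps n ^^ (length w + length ms)"
      unfolding p(1) by (intro up[OF w(1) L(1)]) (use l n in linarith)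
    have "len (wp ks) \<le> length ks'" using S.wlen_le[OF lists_gens(2)[OF L(4)]] p(3) by simp
    then have 2: "(wp ks, wp w' \<otimes> wp zs') \<in> S.ball_steps n ^^ (length w' + length ms')"
      unfolding p(2) p(3)[symmetric] by (intro up[OF w(2) L(2)]) (use l n in linarith)
    have "(wp w \<otimes> wp zs, wp w' \<otimes> wp zs') \<in>
        S.ball_steps n ^^ ((length w + length ms) + (length w' + length ms'))"
      using S.ball_steps_pow_sym[OF 1] 2 by (auto simp: relpow_add)
    moreover have "(length w + length ms) + (length w' + length ms') \<le> (R + B) + (R + B)"
      using R l fB[OF eQ] by linarith
    ultimately show "\<exists>k\<le>(R + B) + (R + B). (wp w \<otimes> wp zs, wp w' \<otimes> wp zs') \<in> S.ball_steps n ^^ k" by blast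
  qed
qed

text \<open>From \<open>g\<close> one goes back \<open>C\<close> letters to \<open>p\<close>,
  crosses to a fellow travelling point \<open>p'\<close> behind \<open>g'\<close>, and goes up to
  \<open>g'\<close>. The crossing consists of a word \<open>v\<close> of length at most
  \<open>K\<close> and a central word \<open>t\<close>, which comes from filling a loop and is short
  enough for the crossing to stay in the ball.\<close>

lemma long_projections:
  fixes m :: nat
  defines "K \<equiv> 9 * \<delta> + 1"
  defines "C \<equiv> 5 * K + 5 * m + 3"
  assumes w: "local_word w" "local_word w'" and zs: "zs \<in> lists Z" "zs' \<in> lists Z"
    and g: "g = wp w \<otimes> wp zs" "g' = wp w' \<otimes> wp zs'"
    and n: "length w + length zs = n" "len g = n" "length w' + length zs' = n" "len g' = n"
    and q: "q \<in> carrier G" "len q \<le> m" "g' = g \<otimes> q" and long: "C < length w"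
  shows "\<exists>k\<le>4 * C. (g, g') \<in> S.ball_steps n ^^ k"
proof -
  have wY: "w \<in> lists Y" "w' \<in> lists Y" using w by (simp_all add: local_word_def)
  define i where "i = length w - C"
  define w1 w2 where "w1 = take i w" and "w2 = drop i w"
  have w12: "w1 \<in> lists Y" "w2 \<in> lists Y" "w = w1 @ w2" "length w2 = C"
    using wY(1) takeY dropY long by (simp_all add: w1_def w2_def i_def del: in_lists_conv_set)
  have gC: "g \<in> carrier G" "g' \<in> carrier G" unfolding g using wY zs wpY wpZ by (simp_all del: in_lists_conv_set)
  have wpC: "wp w \<in> carrier G" "wp w' \<in> carrier G" using wY wpY by blast+
  have hl_w: "\<pi> (wp w) = \<pi> g" "\<pi> (wp w') = \<pi> g'"
    unfolding g using wpC zs wpZ_ker by (simp_all add: hom_mul ker_iff del: in_lists_conv_set)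
  have ends: "wdist H (\<pi> ` Y) (track w (length w)) (track w' (length w')) = hl q"
    using q(1) gC hl_w unfolding track_def q(3)
    by (simp add: hom_mul H.wdist_mult_right hl_def)
  have "hl q \<le> m" using hl_le_len[OF q(1)] q(2) by simp
  have len_w2: "len (wp w1 \<otimes> wp zs) = length w1 + length zs" "len (wp w2) = length w2"
    using geodesic_split[OF w12(1,2) zs(1)] g(1) n w12(3) by simp_all
  have "wdist H (\<pi> ` Y) (track w i) (track w (length w)) = hl (wp w2)"
    using track_dist[OF wY(1), of i "length w"] by (simp add: i_def w2_def)
  \<comment> \<open>By \<open>quasi_geodesic\<close>, \<open>hl (wp w2)\<close> is at least
    \<open>(3 * C - 3) / 5\<close>. With this value of \<open>C\<close> the end of \<open>w\<close>
    is far enough for \<open>fellow_travel\<close>.\<close>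
  moreover have "m + 3 * \<delta> < hl (wp w2)"
  proof -
    have "length w2 = 45 * \<delta> + 5 * m + 8" using w12(4) by (simp add: C_def K_def)
    then show ?thesis using quasi_geodesic[OF w12(2) len_w2(2)] by linarith
  qed
  ultimately have far: "wdist H (\<pi> ` Y) (track w (length w)) (track w' (length w')) + 3 * \<delta>
      < wdist H (\<pi> ` Y) (track w i) (track w (length w))" using ends \<open>hl q \<le> m\<close> by linarith
  have "\<exists>j\<le>length w'. wdist H (\<pi> ` Y) (track w i) (track w' j) \<le> 9 * \<delta> + 1"
    by (rule hyp.fellow_travel[OF local_word_track[OF w(1)] local_word_track[OF w(2)] _ _ _ far])
      (simp_all add: N_def track_def i_def)
  then obtain j where j: "j \<le> length w'" "wdist H (\<pi> ` Y) (track w i) (track w' j) \<le> K"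
    unfolding K_def by blast
  define w1' w2' where "w1' = take j w'" and "w2' = drop j w'"
  have w12': "w1' \<in> lists Y" "w2' \<in> lists Y" "w' = w1' @ w2'"
    using wY(2) takeY dropY by (simp_all add: w1'_def w2'_def del: in_lists_conv_set)
  have len_w2': "len (wp w1' \<otimes> wp zs') = length w1' + length zs'"
    using geodesic_split[OF w12'(1,2) zs(2)] g(2) n w12'(3) by simp
  define p p' where "p = wp w1 \<otimes> wp zs" and "p' = wp w1' \<otimes> wp zs'"
  have gp: "g = p \<otimes> wp w2" "g' = p' \<otimes> wp w2'"
    unfolding g p_def p'_def using nf_split[OF w12(1,2) zs(1)] nf_split[OF w12'(1,2) zs(2)] w12(3) w12'(3) by simp_all
  have len_p: "len p + C = n" "len p' + length w2' = n"
    using len_w2 len_w2' n w12 w12' by (simp_all add: p_def p'_def)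
  have zk: "wp zs \<in> ker" "wp zs' \<in> ker" using zs wpZ_ker by blast+
  have C1: "wp w1 \<in> carrier G" "wp w1' \<in> carrier G" using w12 w12' wpY by blast+
  have pC: "p \<in> carrier G" "p' \<in> carrier G" "wp w2 \<in> carrier G" "wp w2' \<in> carrier G"
    using w12 w12' wpY C1 zk ker_closed by (simp_all add: p_def p'_def del: in_lists_conv_set)
  have "\<pi> p = track w i" "\<pi> p' = track w' j"
    using C1 zk ker_closed by (simp_all add: p_def p'_def track_def w1_def w1'_def hom_mul ker_iff)
  then have hlp: "hl (inv p \<otimes> p') \<le> K"
    using j(2) pC by (simp add: hl_def wdist_def hom_mul hom_inv)
  obtain v where v: "v \<in> lists Y" "length v = hl (inv p \<otimes> p')" "\<pi> (wp v) = \<pi> (inv p \<otimes> p')"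
    using lift_word[of "inv p \<otimes> p'"] pC by blast
  obtain wq zq where wq: "wq \<in> lists Y" "zq \<in> lists Z" "length wq + length zq = len q" "q = wp wq \<otimes> wp zq"
    using ex_sorted[OF q(1)] .
  have qC: "wp v \<in> carrier G" "wp wq \<in> carrier G" "wp zq \<in> carrier G" "wp zq \<in> ker"
    using v(1) wq(1,2) wpY wpZ_ker ker_closed by blast+
  \<comment> \<open>This is the detour from \<open>p\<close> through \<open>g\<close> and
    \<open>g'\<close> to \<open>p'\<close> with the central factor of \<open>q\<close> removed, so
    that it is spelled by letters of \<open>Y\<close> alone.\<close>
  define X where "X = wp w2 \<otimes> (wp wq \<otimes> inv (wp w2'))"
  have XC: "X \<in> carrier G" using pC qC by (simp add: X_def)
  have "p' = p' \<otimes> wp w2' \<otimes> inv (wp w2')" using pC by (simp add: G.m_assoc)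
  also have "\<dots> = p \<otimes> (wp w2 \<otimes> (wp wq \<otimes> (wp zq \<otimes> inv (wp w2'))))"
    using q(3) unfolding gp wq(4) using pC qC by (simp add: G.m_assoc)
  also have "\<dots> = p \<otimes> (X \<otimes> wp zq)"
    using central[OF qC(4), of "inv (wp w2')"] pC qC by (simp add: X_def G.m_assoc)
  finally have p'X: "p' = p \<otimes> (X \<otimes> wp zq)" .
  have "inv p \<otimes> p' = X \<otimes> wp zq" unfolding p'X using pC XC qC by (simp flip: G.m_assoc)
  then have vX: "\<pi> (wp v) = \<pi> X" using v(3) XC qC by (simp add: hom_mul ker_iff)
  define loop where "loop = iw v @ (w2 @ (wq @ iw w2'))"
  have loop: "loop \<in> lists Y" using iw_lists[OF v(1)] iw_lists[OF w12'(2)] w12(2) wq(1) by (simp add: loop_def)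
  have loopX: "wp loop = inv (wp v) \<otimes> X"
    unfolding loop_def X_def using iw_lists[OF v(1)] iw_lists[OF w12'(2)] w12(2) wq(1)
    by (simp add: wp_append wp_iw v(1) w12'(2) append_in_lists_conv del: in_lists_conv_set)
  have "\<pi> (wp loop) = \<one>\<^bsub>H\<^esub>" unfolding loopX using ker_quotient[OF qC(1) XC vX] by (simp add: ker_iff)
  from filling[OF loop this] obtain zl where zl: "zl \<in> lists Z" "4 * length zl \<le> length loop + 3"
    "wp zl = inv (wp v) \<otimes> X" unfolding loopX by blast
  have loop_len: "length loop \<le> K + C + length w2' + length wq"
    using v(2) hlp w12(4) by (simp add: loop_def)
  define t where "t = zl @ zq"
  have t: "t \<in> lists Z" "length t = length zl + length zq" "wp t = wp zl \<otimes> wp zq"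
    using zl(1) wq(2) wpZ_append[OF zl(1) wq(2)] by (simp_all add: t_def)
  have "wp v \<otimes> wp t = X \<otimes> wp zq"
    unfolding t(3) zl(3) using qC XC by (simp flip: G.m_assoc)
  then have p'vt: "p' = p \<otimes> wp (v @ t)"
    using p'X S.wprod_append_lists[OF lists_gens(1)[OF v(1)] lists_gens(2)[OF t(1)]] by simp
  have vt: "v @ t \<in> lists gens" using lists_gens(1)[OF v(1)] lists_gens(2)[OF t(1)] by simp
  have vtC: "wp (v @ t) \<in> carrier G" using S.wprod_lists[OF vt] .
  have "p = p' \<otimes> inv (wp (v @ t))" unfolding p'vt using pC vtC by (simp add: G.m_assoc)
  then have "len p \<le> len p' + len (wp (v @ t))"
    using S.wlen_mult[OF pC(2), of "inv (wp (v @ t))"] S.wlen_inv[OF vtC] vtC by simp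
  then have "len p \<le> len p' + (length v + length t)" using S.wlen_le[OF vt] by simp
  \<comment> \<open>The lengths of \<open>p\<close> and \<open>p'\<close> are \<open>n - C\<close>
    and \<open>n - length w2'\<close>, and they differ by at most the length of the
    crossing.\<close>
  then have tail: "length w2' \<le> C + K + length t" using len_p v(2) hlp by linarith
  have bounds: "4 * length t \<le> K + C + length w2' + 5 * m + 3"
    using zl(2) loop_len t(2) wq(3) q(2) by linarith
  \<comment> \<open>Inserting \<open>tail\<close> into \<open>bounds\<close> gives
    \<open>3 * length t \<le> 2 * K + 2 * C + 5 * m + 3\<close>. Adding \<open>3 * K\<close> turns
    the right side into exactly \<open>3 * C\<close>; this determines the choice of
    \<open>C\<close>.\<close>
  have w2'_le: "length w2' \<le> 2 * C" and t_le: "K + length t \<le> C"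
  proof -
    have "C = 5 * K + 5 * m + 3" by (simp add: C_def)
    then show "length w2' \<le> 2 * C" "K + length t \<le> C" using tail bounds by linarith+
  qed
  have 1: "(p, g) \<in> S.ball_steps n ^^ C"
    using S.ball_steps_up[OF lists_gens(1)[OF w12(2)] pC(1), of n] len_p w12(4) by (simp add: gp)
  \<comment> \<open>The crossing starts \<open>C\<close> below the sphere and has at most
    \<open>K + length t \<le> C\<close> letters.\<close>
  have 2: "(p, p') \<in> S.ball_steps n ^^ (length v + length t)"
    using S.ball_steps_up[OF vt pC(1), of n] len_p t_le v(2) hlp by (simp add: p'vt)
  have 3: "(p', g') \<in> S.ball_steps n ^^ length w2'"
    using S.ball_steps_up[OF lists_gens(1)[OF w12'(2)] pC(2), of n] len_p by (simp add: gp)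
  have "(g, g') \<in> S.ball_steps n ^^ (C + ((length v + length t) + length w2'))"
    using S.ball_steps_pow_sym[OF 1] 2 3 by (auto simp: relpow_add)
  moreover have "C + ((length v + length t) + length w2') \<le> 4 * C"
    using v(2) hlp t_le w2'_le by linarith
  ultimately show ?thesis by blast
qed

text \<open>The length of the \<open>Y\<close>-word of \<open>g\<close> decides the case. If it
  exceeds \<open>C\<close>, the fellow travelling argument applies; otherwise both
  \<open>Y\<close>-words are bounded by \<open>R\<close>.\<close>

lemma almost_convex_gens: "almost_convex G gens"
proof (rule S.almost_convexI)
  fix m
  define C where "C = 5 * (9 * \<delta> + 1) + 5 * m + 3"
  \<comment> \<open>If \<open>length w \<le> C\<close>, the image of \<open>g'\<close> has length at
    most \<open>C + m\<close>, and \<open>quasi_geodesic\<close> gives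
    \<open>3 * length w' \<le> 5 * (C + m) + 3 = R\<close>.\<close>
  define R where "R = 5 * C + 5 * m + 3"
  obtain B where B: "\<And>w w' zs zs' q n. w \<in> lists Y \<Longrightarrow> w' \<in> lists Y \<Longrightarrow> zs \<in> lists Z \<Longrightarrow> zs' \<in> lists Z \<Longrightarrow>
     q \<in> carrier G \<Longrightarrow> length w \<le> R \<Longrightarrow> length w' \<le> R \<Longrightarrow> len q \<le> R \<Longrightarrow>
     wp w' \<otimes> wp zs' = wp w \<otimes> wp zs \<otimes> q \<Longrightarrow> length w + length zs = n \<Longrightarrow> length w' + length zs' = n \<Longrightarrow>
     \<exists>k\<le>B. (wp w \<otimes> wp zs, wp w' \<otimes> wp zs') \<in> S.ball_steps n ^^ k"
    using short_projections[of R] by blast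
  have "\<exists>k\<le>max (4 * C) B. (g, g') \<in> S.ball_steps (len g) ^^ k"
    if g: "g \<in> carrier G" "g' \<in> carrier G" and l: "len g = len g'" and d: "wdist G gens g g' \<le> m" for g g'
  proof -
    obtain w zs where w: "local_word w" "w \<in> lists Y" "zs \<in> lists Z" "length w + length zs = len g"
      "g = wp w \<otimes> wp zs" using geodesic_form[OF g(1)] .
    obtain w' zs' where w': "local_word w'" "w' \<in> lists Y" "zs' \<in> lists Z" "length w' + length zs' = len g'"
      "g' = wp w' \<otimes> wp zs'" using geodesic_form[OF g(2)] .
    define q where "q = inv g \<otimes> g'"
    have q: "q \<in> carrier G" "len q \<le> m" "g' = g \<otimes> q"
      using g d unfolding q_def wdist_def by (simp_all flip: G.m_assoc)
    show ?thesis
    proof (cases "C < length w")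
      case True
      from long_projections[OF w(1) w'(1) w(3) w'(3) w(5) w'(5) w(4) refl _ l[symmetric] q] True w'(4) l
      show ?thesis unfolding C_def by (metis max.coboundedI1)
    next
      case False
      have C: "wp w \<in> carrier G" "wp w' \<in> carrier G" using w(2) w'(2) wpY by blast+
      have "len (wp w') = length w'"
        using geodesic_split(2)[of "[]" w' zs'] w' by simp
      from quasi_geodesic[OF w'(2) this] have "3 * length w' \<le> 5 * hl (wp w') + 3" .
      moreover have "hl (wp w') = hl g'" unfolding w'(5) using hl_mult_ker[OF C(2) wpZ_ker[OF w'(3)]] by simp
      moreover have "hl g' \<le> hl g + hl q" unfolding q(3) using hl_mult[OF g(1) q(1)] .
      moreover have "hl g = hl (wp w)" unfolding w(5) using hl_mult_ker[OF C(1) wpZ_ker[OF w(3)]] .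
      ultimately have "length w' \<le> R"
        using hl_word[OF w(2)] hl_le_len[OF q(1)] q(2) False unfolding R_def by linarith
      moreover have "length w \<le> R" "len q \<le> R" using False q(2) by (simp_all add: R_def)
      ultimately have "\<exists>k\<le>B. (wp w \<otimes> wp zs, wp w' \<otimes> wp zs') \<in> S.ball_steps (len g) ^^ k"
        using B[OF w(2) w'(2) w(3) w'(3) q(1)] w(4,5) w'(4,5) q(3) l by simp
      then show ?thesis using w(5) w'(5) by (metis max.coboundedI2)
    qed
  qed
  then show "\<exists>K. \<forall>g\<in>carrier G. \<forall>g'\<in>carrier G. len g = len g' \<longrightarrow> wdist G gens g g' \<le> m \<longrightarrow>
      (\<exists>k\<le>K. (g, g') \<in> S.ball_steps (len g) ^^ k)" by blast
qed

end

section \<open>Lifting the generators and conclusion\<close>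

theorem theorem2:
  fixes A :: "('a, 'd) monoid_scheme"
    and G :: "('g, 'e) monoid_scheme"
    and H :: "('h, 'f) monoid_scheme"
    and \<iota> :: "'a \<Rightarrow> 'g"
    and \<pi> :: "'g \<Rightarrow> 'h"
  assumes "word_hyperbolic H"
    and "comm_group A"
    and "finitely_generated A"
    and "central_extension A G H \<iota> \<pi>"
  shows "\<exists>S. generating_set G S \<and> almost_convex G S"
proof -
  from assms(1) obtain X e where H: "group H" and X: "generating_set H X" and e: "thin_triangles H X e"
    unfolding word_hyperbolic_def by blast
  from assms(3) obtain T where T: "generating_set A T" unfolding finitely_generated_def by blast
  have ext: "group A" "group G" "\<iota> \<in> hom A G" "\<pi> \<in> hom G H" "\<pi> ` carrier G = carrier H"
    "\<iota> ` carrier A = kernel G H \<pi>"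
    "\<And>a g. a \<in> carrier A \<Longrightarrow> g \<in> carrier G \<Longrightarrow> \<iota> a \<otimes>\<^bsub>G\<^esub> g = g \<otimes>\<^bsub>G\<^esub> \<iota> a"
    using assms(4) unfolding central_extension_def by blast+
  interpret G: group G by fact
  interpret H: group H by fact
  interpret A: group A by fact
  interpret \<iota>: group_hom A G \<iota> using ext by unfold_locales
  interpret \<pi>: group_hom G H \<pi> using ext by unfold_locales
  have X': "finite X" "X \<subseteq> carrier H" "\<And>x. x \<in> X \<Longrightarrow> inv\<^bsub>H\<^esub> x \<in> X" "generate H X = carrier H"
    using X by (simp_all add: generating_set_def)
  have T': "finite T" "T \<subseteq> carrier A" "\<And>x. x \<in> T \<Longrightarrow> inv\<^bsub>A\<^esub> x \<in> T" "generate A T = carrier A"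
    using T by (simp_all add: generating_set_def)
  have "\<forall>x\<in>X. \<exists>g. g \<in> carrier G \<and> \<pi> g = x"
  proof
    fix x assume "x \<in> X"
    then have "x \<in> \<pi> ` carrier G" unfolding ext(5) using X'(2) by (rule rev_subsetD)
    then show "\<exists>g. g \<in> carrier G \<and> \<pi> g = x" by blast
  qed
  from bchoice[OF this] obtain s where s: "\<forall>x\<in>X. s x \<in> carrier G \<and> \<pi> (s x) = x" ..
  \<comment> \<open>The choice \<open>s\<close> need not respect inversion, so inverses are added in
    \<open>G\<close>. The image is still \<open>X\<close> because \<open>X\<close> is
    symmetric.\<close>
  define Y where "Y = s ` X \<union> m_inv G ` s ` X"
  have sC: "s ` X \<subseteq> carrier G" using s by blast
  have Y: "finite Y" "Y \<subseteq> carrier G" using X'(1) sC by (auto simp: Y_def)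
  have Y_inv: "inv\<^bsub>G\<^esub> a \<in> Y" if "a \<in> Y" for a
  proof -
    have "inv\<^bsub>G\<^esub> (inv\<^bsub>G\<^esub> x) = x" if "x \<in> s ` X" for x using that sC by auto
    then show ?thesis using that unfolding Y_def by auto
  qed
  have \<pi>Y: "\<pi> ` Y = X"
  proof
    show "\<pi> ` Y \<subseteq> X" using s X'(3) by (auto simp: Y_def)
    show "X \<subseteq> \<pi> ` Y"
    proof
      fix x assume "x \<in> X"
      then show "x \<in> \<pi> ` Y" using s by (intro image_eqI[of _ _ "s x"]) (auto simp: Y_def)
    qed
  qed
  \<comment> \<open>By exactness the image of a generating set of \<open>A\<close> generates the
    kernel of \<open>\<pi>\<close>.\<close>
  define T\<^sub>G where "T\<^sub>G = \<iota> ` T"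
  have TG: "finite T\<^sub>G" "T\<^sub>G \<subseteq> kernel G H \<pi>" using T'(1,2) ext(6) by (auto simp: T\<^sub>G_def)
  have TG_inv: "inv\<^bsub>G\<^esub> a \<in> T\<^sub>G" if a: "a \<in> T\<^sub>G" for a
  proof -
    obtain x where x: "x \<in> T" "a = \<iota> x" using a by (auto simp: T\<^sub>G_def)
    then have "inv\<^bsub>G\<^esub> a = \<iota> (inv\<^bsub>A\<^esub> x)" using T'(2) by auto
    then show ?thesis using T'(3)[OF x(1)] by (simp add: T\<^sub>G_def)
  qed
  have TG_gen: "generate G T\<^sub>G = kernel G H \<pi>"
    unfolding T\<^sub>G_def using \<iota>.generate_img[OF T'(2)] T'(4) ext(6) by simp
  interpret XC: cayley H X using X' by unfold_locales auto
  interpret hyp: disc_hyperbolic "carrier H" "wdist H X" "nat \<lceil>e\<rceil> + 2" using XC.disc_hyperbolic[OF e] .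
  interpret central_hyperbolic G H \<pi> Y "nat \<lceil>e\<rceil> + 2" T\<^sub>G
  proof (unfold_locales, unfold \<pi>Y)
    show "k \<otimes>\<^bsub>G\<^esub> g = g \<otimes>\<^bsub>G\<^esub> k" if "k \<in> kernel G H \<pi>" "g \<in> carrier G" for k g
      using that ext(6,7) by (metis imageE)
  qed (use X' Y Y_inv TG TG_inv TG_gen ext XC.disc_hyperbolic[OF e] in \<open>auto simp: disc_hyperbolic_def\<close>)
  show ?thesis using gens_generating_set almost_convex_gens by blast
qed

end
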